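(* Suppose the model is linear, $q(x,a;\tau)=t(x,a)^\top\tau$ with $\tau\in\mathbb R^{d_\tau}$, where $t$ is a bounded vector of $d_\tau$ linearly independent basis functions not including a constant, and let $g=(\mathcal F(1),\mathcal F(t_1),\dots,\mathcal F(t_{d_\tau}))^\top$ with $\mathrm E[gg^\top]$ nonsingular. Let $(\hat\xi,\hat\tau)$ maximize $\mathrm E_n[\log\{1+\mathcal F(\xi+t^\top\tau)\}]$ over $(\xi,\tau)\in\mathbb R\times\mathbb R^{d_\tau}$ (with $1+\mathcal F(\xi+t^\top\tau)>0$ at all data points), $\hat c=\mathrm E_n[\{1+\mathcal F(\hat\xi+t^\top\hat\tau)\}^{-1}]$ and $\hat\beta_{\mathrm{emp}}=\mathrm E_n[\hat c^{-1}wr/\{1+\mathcal F(\hat\xi+t^\top\hat\tau)\}]$. Then $$\mathrm{Asmse}[\hat\beta_{\mathrm{emp}}]=n^{-1}\min_{\zeta\in\mathbb R,\ \tau\in\mathbb R^{d_\tau}}\Big(\mathrm E\big[\{wr-\mathcal F(\zeta+t^\top\tau)\}^2\big]-{\beta^*}^2\Big).$$ Consequently: (intrinsic efficiency) $\mathrm{Asmse}[\hat\beta_{\mathrm{emp}}]\le\min\{n^{-1}\mathrm{var}(wr),\,n^{-1}\mathrm{var}(w(r-\beta^* )),\,n^{-1}\mathrm{var}(wr-\mathcal F(t^\top\tau^\dagger))\}$ for every $\tau^\dagger\in\mathbb R^{d_\tau}$; and (local efficiency) if $Q(x,a):=\mathrm E[r\mid x,a]=t(x,a)^\top\tau_0$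 for some $\tau_0$, then $\mathrm{Asmse}[\hat\beta_{\mathrm{emp}}]=n^{-1}\mathrm{var}\big(w(r-Q(x,a))+\sum_{a'}Q(x,a')\pi_e(a'|x)\big)$.
   Context: Contextual bandit setting. $\mathcal A$ is a finite action set. The data are $n$ i.i.d. triples $(x^{(i)},a^{(i)},r^{(i)})$, each distributed as $(x,a,r)$ where $x\sim P_0$, $a\mid x\sim\pi_b(\cdot\mid x)$ and $r\mid(x,a)\sim P_r(x,a)$ with $r\in[0,R_{\max}]$. $\pi_e$ is the evaluation policy, overlap holds, and $w=w(x,a)=\pi_e(a|x)/\pi_b(a|x)$ is bounded. $\mathrm E,\mathrm{var}$ are under the behavior distribution, $\mathrm E_n[f]=n^{-1}\sum_{i=1}^n f(x^{(i)},a^{(i)},r^{(i)})$, $\beta^*=\mathrm E[wr]$. For $m:\mathcal X\times\mathcal A\to\mathbb R$, $\mathcal F(m)(x,a)=w(x,a)m(x,a)-\sum_{a'\in\mathcal A}m(x,a')\pi_e(a'|x)$; $1$ denotes the constant function, so $\mathcal F(1)=w-1$. The quantities $n^{-1}\mathrm{var}(wr)$, $n^{-1}\mathrm{var}(w(r-\beta^* ))$, $n^{-1}\mathrm{var}(wr-\mathcal F(q(\cdot;\tau^\dagger)))$ are the asymptotic MSEs of IS $\mathrm E_n[wr]$, SNIS $\mathrm E_n[wr]/\mathrm E_n[w]$, and the DR estimator $\mathrm E_n[wr-\mathcal F(q(\cdot;\tilde\tau))]$ with $\tilde\tau\to\tau^\dagger$ in probability. For $\hat\beta$ with $\sqrt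 n(\hat\beta-\beta^* )\to N(0,\sigma^2)$ in distribution, $\mathrm{Asmse}[\hat\beta]=n^{-1}\sigma^2$. *)

theory Defs
  imports "HOL-Probability.Probability"
begin

definition wt :: "('x \<Rightarrow> 'a pmf) \<Rightarrow> ('x \<Rightarrow> 'a pmf) \<Rightarrow> 'x \<Rightarrow> 'a \<Rightarrow> real" where
  "wt pie pib x a = pmf (pie x) a / pmf (pib x) a"

definition Fop :: "('x \<Rightarrow> 'a pmf) \<Rightarrow> ('x \<Rightarrow> 'a pmf) \<Rightarrow> ('x \<Rightarrow> 'a::finite \<Rightarrow> real)
                    \<Rightarrow> 'x \<Rightarrow> 'a \<Rightarrow> real" where
  "Fop pie pib m x a = wt pie pib x a * m x a - (\<Sum>a'\<in>UNIV. m x a' * pmf (pie x) a')"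

definition obs_space :: "'x measure \<Rightarrow> ('x \<times> 'a \<times> real) measure" where
  "obs_space P0 = P0 \<Otimes>\<^sub>M (count_space UNIV \<Otimes>\<^sub>M borel)"

definition data_dist :: "'x measure \<Rightarrow> ('x \<Rightarrow> 'a pmf) \<Rightarrow> ('x \<Rightarrow> 'a \<Rightarrow> real measure)
                          \<Rightarrow> ('x \<times> 'a \<times> real) measure" where
  "data_dist P0 pib Pr =
     P0 \<bind> (\<lambda>x. measure_pmf (pib x) \<bind> (\<lambda>a. Pr x a \<bind>
        (\<lambda>r. return (obs_space P0) (x, a, r))))"

definition var_D :: "'b measure \<Rightarrow> ('b \<Rightarrow> real) \<Rightarrow> real" where
  "var_D D f = (\<integral>z. (f z - (\<integral>u. f u \<partial>D))\<^sup>2 \<partial>D)"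

definition normal_law :: "real \<Rightarrow> real measure" where
  "normal_law s2 = (if s2 = 0 then return borel 0
                    else density lborel (normal_density 0 (sqrt s2)))"

(* sqrt n (est_n - b) -> N(0, s2) in distribution; then Asmse[est] = s2 / n *)
definition asymp_normal :: "'w measure \<Rightarrow> (nat \<Rightarrow> 'w \<Rightarrow> real) \<Rightarrow> real \<Rightarrow> real \<Rightarrow> bool" where
  "asymp_normal M est b s2 \<longleftrightarrow>
     weak_conv_m (\<lambda>n. distr M borel (\<lambda>\<omega>. sqrt (real n) * (est n \<omega> - b))) (normal_law s2)"

definition emp_mean :: "nat \<Rightarrow> (nat \<Rightarrow> 'w \<Rightarrow> 'z) \<Rightarrow> 'w \<Rightarrow> ('z \<Rightarrow> real) \<Rightarrow> real" where
  "emp_mean n Z \<omega> f = (\<Sum>i<n. f (Z i \<omega>)) / real n"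

definition lin_model :: "('x \<Rightarrow> 'a \<Rightarrow> real^'d) \<Rightarrow> real \<Rightarrow> real^'d \<Rightarrow> 'x \<Rightarrow> 'a \<Rightarrow> real" where
  "lin_model t xi tau x a = xi + t x a \<bullet> tau"

definition emp_loglik where
  "emp_loglik pie pib t n Z \<omega> xi tau =
     emp_mean n Z \<omega> (\<lambda>(x,a,r). ln (1 + Fop pie pib (lin_model t xi tau) x a))"

definition feasible where
  "feasible pie pib t n Z \<omega> xi tau \<longleftrightarrow>
     (\<forall>i<n. case Z i \<omega> of (x,a,r) \<Rightarrow> 1 + Fop pie pib (lin_model t xi tau) x a > 0)"

definition is_emp_max where
  "is_emp_max pie pib t n Z \<omega> xi tau \<longleftrightarrow>
     feasible pie pib t n Z \<omega> xi tau \<and>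
     (\<forall>xi' tau'. feasible pie pib t n Z \<omega> xi' tau' \<longrightarrow>
        emp_loglik pie pib t n Z \<omega> xi' tau' \<le> emp_loglik pie pib t n Z \<omega> xi tau)"

definition c_hat where
  "c_hat pie pib t n Z \<omega> xi tau =
     emp_mean n Z \<omega> (\<lambda>(x,a,r). 1 / (1 + Fop pie pib (lin_model t xi tau) x a))"

definition beta_emp where
  "beta_emp pie pib t n Z \<omega> xi tau =
     emp_mean n Z \<omega> (\<lambda>(x,a,r). wt pie pib x a * r /
        (c_hat pie pib t n Z \<omega> xi tau * (1 + Fop pie pib (lin_model t xi tau) x a)))"

definition gvec :: "('x \<Rightarrow> 'a pmf) \<Rightarrow> ('x \<Rightarrow> 'a pmf) \<Rightarrow> ('x \<Rightarrow> 'a::finite \<Rightarrow> real^'d)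
                    \<Rightarrow> 'x \<Rightarrow> 'a \<Rightarrow> real^('d option)" where
  "gvec pie pib t x a = (\<chi> i. case i of None \<Rightarrow> Fop pie pib (\<lambda>_ _. 1) x a
                                  | Some j \<Rightarrow> Fop pie pib (\<lambda>x a. t x a $ j) x a)"

definition gram :: "('x \<times> 'a \<times> real) measure \<Rightarrow> ('x \<Rightarrow> 'a pmf) \<Rightarrow> ('x \<Rightarrow> 'a pmf)
                    \<Rightarrow> ('x \<Rightarrow> 'a::finite \<Rightarrow> real^'d) \<Rightarrow> real^('d option)^('d option)" where
  "gram D pie pib t = (\<chi> i j. \<integral>(x,a,r). gvec pie pib t x a $ i * gvec pie pib t x a $ j \<partial>D)"

end

theory Submission
  imports Defs
begin

text \<open>
  With \<open>\<theta> = (\<xi>, \<tau>)\<close> one has \<open>\<F>(\<xi> + t\<^sup>T\<tau>) = g \<bullet> \<theta>\<close>, where \<open>g\<close> is bounded, has mean zero and positive definite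
  second moment matrix \<open>S\<close>. The maximizer satisfies the empirical equation \<open>E\<^sub>n[g / (1 + g \<bullet> \<theta>)] = 0\<close>; testing it
  with \<open>\<theta>\<close> gives \<open>c = 1\<close> and Owen's bound \<open>\<bar>\<theta>\<bar> = O(\<bar>E\<^sub>n g\<bar>)\<close>, and expanding \<open>1 / (1 + y) = 1 - y + y\<^sup>2 / (1 + y)\<close>
  gives \<open>\<beta>\<^sub>e\<^sub>m\<^sub>p = E\<^sub>n[h - g \<bullet> \<theta>\<^sup>*]\<close> up to a constant times \<open>\<Delta>\<^sub>n\<close>. Here \<open>h = w r\<close>, \<open>g \<bullet> \<theta>\<^sup>*\<close> is the
  \<open>L\<^sup>2\<close>-projection of \<open>h\<close> onto the span of \<open>g\<close>, and \<open>\<Delta>\<^sub>n\<close> is the sum of the squared deviations of the empirical means of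
  \<open>g\<close>, \<open>g g\<^sup>T\<close> and \<open>h g\<close> from their expectations. As \<open>E \<Delta>\<^sub>n = O(1/n)\<close>, the central limit theorem and Slutsky's argument
  give the limit law with variance \<open>E(h - g \<bullet> \<theta>\<^sup>*)\<^sup>2 - \<beta>\<^sup>2\<close>. Efficiency is the minimality of the projection; in
  the well-specified case \<open>g \<bullet> (0, \<tau>\<^sub>0)\<close> is itself the projection.
\<close>

subsection \<open>Slutsky perturbation and the central limit theorem\<close>

text \<open>Factoring out \<open>iexp b\<close>, which has modulus 1, leaves
  \<open>iexp (a - b) - 1\<close>, bounded by the first-order Taylor estimate.\<close>

lemma norm_iexp_diff_le: "cmod (iexp a - iexp b) \<le> \<bar>a - b\<bar>"
proof -
  have "iexp a - iexp b = iexp b * (iexp (a - b) - 1)"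
    by (simp add: right_diff_distrib flip: exp_add)
  then have "cmod (iexp a - iexp b) = cmod (iexp (a - b) - 1)"
    by (simp add: norm_mult)
  also have "\<dots> \<le> \<bar>a - b\<bar>"
    using iexp_approx1[of "a - b" 0] by simp
  finally show ?thesis .
qed

text \<open>Where X and Y are within e the integrands differ by at most
  \<open>\<bar>t\<bar> * e\<close>; elsewhere they differ by at most 2, both being unimodular.
  Closeness in probability thus becomes closeness of characteristic functions.\<close>

lemma (in prob_space) char_distr_diff_le:
  fixes X Y :: "'a \<Rightarrow> real"
  assumes [measurable]: "X \<in> borel_measurable M" "Y \<in> borel_measurable M" and "0 \<le> e"
  shows "cmod (char (distr M borel Y) t - char (distr M borel X) t)
    \<le> \<bar>t\<bar> * e + 2 * prob {\<omega>\<in>space M. e < \<bar>Y \<omega> - X \<omega>\<bar>}"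
proof -
  let ?B = "{\<omega>\<in>space M. e < \<bar>Y \<omega> - X \<omega>\<bar>}"
  have intgX: "integrable M (\<lambda>\<omega>. iexp (t * X \<omega>))" and intgY: "integrable M (\<lambda>\<omega>. iexp (t * Y \<omega>))"
    by (auto intro!: integrable_iexp simp del: of_real_mult)
  have "char (distr M borel Y) t - char (distr M borel X) t
      = (\<integral>\<omega>. iexp (t * Y \<omega>) - iexp (t * X \<omega>) \<partial>M)"
    unfolding char_def using intgX intgY by (simp add: integral_distr)
  also have "cmod \<dots> \<le> (\<integral>\<omega>. cmod (iexp (t * Y \<omega>) - iexp (t * X \<omega>)) \<partial>M)"
    by (rule integral_norm_bound)
  also have "\<dots> \<le> (\<integral>\<omega>. \<bar>t\<bar> * e + 2 * indicator ?B \<omega> \<partial>M)"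
  proof (rule integral_mono)
    show "integrable M (\<lambda>\<omega>. cmod (iexp (t * Y \<omega>) - iexp (t * X \<omega>)))"
      using intgX intgY by auto
    fix \<omega> assume \<omega>: "\<omega> \<in> space M"
    show "cmod (iexp (t * Y \<omega>) - iexp (t * X \<omega>)) \<le> \<bar>t\<bar> * e + 2 * indicator ?B \<omega>"
    proof (cases "\<omega> \<in> ?B")
      case True
      have "cmod (iexp (t * Y \<omega>) - iexp (t * X \<omega>)) \<le> 1 + 1"
        by (rule norm_triangle_le_diff) (simp del: of_real_mult)
      moreover have "0 \<le> \<bar>t\<bar> * e"
        using \<open>0 \<le> e\<close> by simp
      ultimately show ?thesis
        using True by simp
    next
      case False
      have "cmod (iexp (t * Y \<omega>) - iexp (t * X \<omega>)) \<le> \<bar>t * Y \<omega> - t * X \<omega>\<bar>"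
        by (rule norm_iexp_diff_le)
      also have "\<dots> = \<bar>t\<bar> * \<bar>Y \<omega> - X \<omega>\<bar>"
        by (simp flip: abs_mult right_diff_distrib)
      also have "\<dots> \<le> \<bar>t\<bar> * e"
        using False \<omega> by (intro mult_left_mono) auto
      finally show ?thesis
        using False by simp
    qed
  qed (auto intro!: integrable_real_indicator simp: emeasure_eq_measure)
  also have "\<dots> = \<bar>t\<bar> * e + 2 * prob ?B"
    by (subst Bochner_Integration.integral_add) (auto simp: prob_space emeasure_eq_measure)
  finally show ?thesis .
qed

text \<open>Slutsky's argument through Levy continuity: the characteristic functions of
  \<open>X n\<close> converge, and those of \<open>Y n\<close> differ from them by a null
  sequence.\<close>

lemma (in prob_space) weak_conv_m_perturb:
  fixes X Y :: "nat \<Rightarrow> 'a \<Rightarrow> real"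
  assumes X: "\<And>n. X n \<in> borel_measurable M" and Y: "\<And>n. Y n \<in> borel_measurable M"
    and L: "real_distribution L"
    and conv: "weak_conv_m (\<lambda>n. distr M borel (X n)) L"
    and close: "\<And>e. 0 < e \<Longrightarrow> (\<lambda>n. prob {\<omega>\<in>space M. e < \<bar>Y n \<omega> - X n \<omega>\<bar>}) \<longlonglongrightarrow> 0"
  shows "weak_conv_m (\<lambda>n. distr M borel (Y n)) L"
proof (rule levy_continuity)
  show "real_distribution (distr M borel (Y n))" for n
    using Y by (rule real_distribution_distr)
  show "real_distribution L" by fact
  fix t :: real
  have "(\<lambda>n. char (distr M borel (X n)) t) \<longlonglongrightarrow> char L t"
    using X L conv by (intro levy_continuity1 real_distribution_distr)
  moreover have "(\<lambda>n. char (distr M borel (Y n)) t - char (distr M borel (X n)) t) \<longlonglongrightarrow> 0"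
  proof (rule LIMSEQ_I)
    fix r :: real assume "0 < r"
    \<comment> \<open>The closeness term then costs at most r/2, and an exceptional probability
      below r/4 costs less than the other half. The summand 1 covers t = 0.\<close>
    define e where "e = r / (2 * (\<bar>t\<bar> + 1))"
    have "0 < e"
      using \<open>0 < r\<close> by (auto simp: e_def)
    have "\<bar>t\<bar> * e \<le> (\<bar>t\<bar> + 1) * e"
      using \<open>0 < e\<close> by (intro mult_right_mono) auto
    also have "\<dots> = r / 2"
      by (simp add: e_def field_simps)
    finally have te: "\<bar>t\<bar> * e \<le> r / 2" .
    have "eventually (\<lambda>n. prob {\<omega>\<in>space M. e < \<bar>Y n \<omega> - X n \<omega>\<bar>} < r / 4) sequentially"
      using close[OF \<open>0 < e\<close>] \<open>0 < r\<close> by (intro order_tendstoD) auto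
    then have "eventually (\<lambda>n. norm (char (distr M borel (Y n)) t - char (distr M borel (X n)) t - 0) < r) sequentially"
    proof eventually_elim
      case (elim n)
      then show ?case
        using char_distr_diff_le[OF X[of n] Y[of n] less_imp_le[OF \<open>0 < e\<close>], of t] te by simp
    qed
    then show "\<exists>no. \<forall>n\<ge>no. norm (char (distr M borel (Y n)) t - char (distr M borel (X n)) t - 0) < r"
      by (simp add: eventually_sequentially)
  qed
  ultimately show "(\<lambda>n. char (distr M borel (Y n)) t) \<longlonglongrightarrow> char L t"
    by (rule Lim_transform)
qed

section \<open>Normal limit laws, including the degenerate one\<close>

lemma real_distribution_normal_law:
  assumes "0 \<le> v"
  shows "real_distribution (normal_law v)"
proof (cases "v = 0")
  case True
  then show ?thesis
    by (auto simp: normal_law_def real_distribution_def real_distribution_axioms_def intro!: prob_space_return)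
next
  case False
  then show ?thesis
    using assms prob_space_normal_density[of "sqrt v" 0]
    by (simp add: normal_law_def real_distribution_def real_distribution_axioms_def)
qed

text \<open>A point mass at 0 has characteristic function 1, so one formula serves v = 0 as well;
  for v > 0 the law is the image of the standard normal law under scaling by
  \<open>sqrt v\<close>.\<close>

lemma char_normal_law:
  assumes "0 \<le> v"
  shows "char (normal_law v) t = exp (- (v * t\<^sup>2) / 2)"
proof (cases "v = 0")
  case True
  then show ?thesis
    by (simp add: normal_law_def char_def integral_return)
next
  case False
  then have "0 < v" using assms by simp
  interpret std: prob_space std_normal_distribution
    by (rule prob_space_normal_density) simp
  have "distributed std_normal_distribution lborel (\<lambda>x. x) std_normal_density"
    unfolding distributed_def by (auto simp: distr_id2)
  then have "distributed std_normal_distribution lborel (\<lambda>x. 0 + sqrt v * x) (normal_density (0 + sqrt v * 0) (\<bar>sqrt v\<bar> * 1))"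
    using \<open>0 < v\<close> by (intro std.normal_density_affine) auto
  then have "distr std_normal_distribution lborel (\<lambda>x. sqrt v * x) = density lborel (normal_density 0 (sqrt v))"
    using \<open>0 < v\<close> by (simp add: distributed_def)
  then have "normal_law v = distr std_normal_distribution lborel (\<lambda>x. sqrt v * x)"
    using False by (simp add: normal_law_def)
  then have "char (normal_law v) t = char std_normal_distribution (t * sqrt v)"
    unfolding char_def by (simp add: integral_distr mult.assoc)
  then show ?thesis
    using \<open>0 < v\<close> by (simp add: char_std_normal_distribution power_mult_distrib mult.commute)
qed

text \<open>For v = 0 the summands vanish almost surely and the limit is the point mass at 0. For v
  > 0 the standardized theorem is rescaled on characteristic functions: dividing the sum by
  \<open>sqrt (n * v)\<close> and evaluating at \<open>t * sqrt v\<close> is the same as dividing by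
  \<open>sqrt n\<close> and evaluating at t.\<close>

lemma (in prob_space) central_limit_theorem_normal_law:
  fixes X :: "nat \<Rightarrow> 'a \<Rightarrow> real"
  assumes indep: "indep_vars (\<lambda>i. borel) X UNIV"
    and mean: "\<And>n. expectation (X n) = 0"
    and sq: "\<And>n. integrable M (\<lambda>x. (X n x)\<^sup>2)"
    and var: "\<And>n. expectation (\<lambda>x. (X n x)\<^sup>2) = v"
    and dist: "\<And>n. distr M borel (X n) = \<mu>"
  shows "weak_conv_m (\<lambda>n. distr M borel (\<lambda>x. (\<Sum>i<n. X i x) / sqrt n)) (normal_law v)"
proof -
  have v: "0 \<le> v"
    using var[of 0] by (metis integral_nonneg_AE AE_I2 zero_le_power2)
  have X[measurable]: "X n \<in> borel_measurable M" for n
    using indep unfolding indep_vars_def2 by simp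
  show ?thesis
  proof (rule levy_continuity)
    show "real_distribution (distr M borel (\<lambda>x. (\<Sum>i<n. X i x) / sqrt n))" for n
      by (rule real_distribution_distr) simp
    show "real_distribution (normal_law v)"
      using v by (rule real_distribution_normal_law)
    fix t :: real
    show "(\<lambda>n. char (distr M borel (\<lambda>x. (\<Sum>i<n. X i x) / sqrt n)) t) \<longlonglongrightarrow> char (normal_law v) t"
    proof (cases "v = 0")
      case True
      have "AE x in M. X i x = 0" for i
      proof -
        have "AE x in M. (X i x)\<^sup>2 = 0"
          using integral_nonneg_eq_0_iff_AE[OF sq[of i]] var[of i] True by simp
        then show ?thesis by simp
      qed
      then have AE0: "AE x in M. \<forall>i. X i x = 0"
        by (simp add: AE_all_countable)
      have "distr M borel (\<lambda>x. (\<Sum>i<n. X i x) / sqrt n) = distr M borel (\<lambda>x. 0)" for n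
        using AE0 by (intro distr_cong_AE) auto
      then have "char (distr M borel (\<lambda>x. (\<Sum>i<n. X i x) / sqrt n)) t = 1" for n
        by (simp add: char_def integral_return)
      then show ?thesis
        using True by (simp add: char_normal_law)
    next
      case False
      then have "0 < sqrt v" using v by simp
      have "weak_conv_m (\<lambda>n. distr M borel (\<lambda>x. (\<Sum>i<n. X i x) / sqrt (n * (sqrt v)\<^sup>2))) std_normal_distribution"
        using indep mean \<open>0 < sqrt v\<close> sq _ dist
        by (rule central_limit_theorem_zero_mean) (simp add: mean var v)
      then have "(\<lambda>n. char (distr M borel (\<lambda>x. (\<Sum>i<n. X i x) / sqrt (n * (sqrt v)\<^sup>2))) (t * sqrt v))
          \<longlonglongrightarrow> char std_normal_distribution (t * sqrt v)"
        by (intro levy_continuity1 real_distribution_distr real_dist_normal_dist) auto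
      moreover have "char (distr M borel (\<lambda>x. (\<Sum>i<n. X i x) / sqrt (n * (sqrt v)\<^sup>2))) (t * sqrt v)
          = char (distr M borel (\<lambda>x. (\<Sum>i<n. X i x) / sqrt n)) t" for n
        using \<open>0 < sqrt v\<close> by (simp add: char_def integral_distr real_sqrt_mult)
      moreover have "char std_normal_distribution (t * sqrt v) = char (normal_law v) t"
        using v by (simp add: char_normal_law char_std_normal_distribution power_mult_distrib mult.commute)
      ultimately show ?thesis by simp
    qed
  qed
qed

text \<open>The squared sum is a double sum whose off-diagonal terms have zero expectation by
  independence and centering.\<close>

lemma (in prob_space) second_moment_sum_indep:
  fixes X :: "nat \<Rightarrow> 'a \<Rightarrow> real"
  assumes indep: "indep_vars (\<lambda>i. borel) X UNIV"
    and mean: "\<And>n. expectation (X n) = 0"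
    and sq: "\<And>n. integrable M (\<lambda>x. (X n x)\<^sup>2)"
  shows "integrable M (\<lambda>x. (\<Sum>i<n. X i x)\<^sup>2)" (is "?I n")
    and "expectation (\<lambda>x. (\<Sum>i<n. X i x)\<^sup>2) = (\<Sum>i<n. expectation (\<lambda>x. (X i x)\<^sup>2))" (is "?E n")
proof -
  have [measurable]: "X n \<in> borel_measurable M" for n
    using indep unfolding indep_vars_def2 by simp
  have int: "integrable M (X n)" for n
    by (rule square_integrable_imp_integrable[OF _ sq]) simp
  have cross: "integrable M (\<lambda>x. X i x * X j x) \<and> expectation (\<lambda>x. X i x * X j x) =
      (if i = j then expectation (\<lambda>x. (X i x)\<^sup>2) else 0)" for i j
  proof (cases "i = j")
    case True
    then show ?thesis
      using sq by (simp add: power2_eq_square)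
  next
    case False
    have "indep_vars (\<lambda>i. borel) X {i, j}"
      using indep by (rule indep_vars_subset) simp
    then show ?thesis
      using indep_vars_lebesgue_integral[of "{i, j}" X] indep_vars_integrable[of "{i, j}" X] int mean False
      by simp
  qed
  have eq: "(\<lambda>x. (\<Sum>i<n. X i x)\<^sup>2) = (\<lambda>x. \<Sum>i<n. \<Sum>j<n. X i x * X j x)" for n
    by (simp add: power2_eq_square sum_product)
  show "?I n" unfolding eq using cross by auto
  show "?E n"
    unfolding eq using cross by (simp add: Bochner_Integration.integral_sum)
qed

subsection \<open>Expansion of the empirical likelihood estimator\<close>

lemma emp_mean_add: "emp_mean n Z \<omega> (\<lambda>z. f z + f' z) = emp_mean n Z \<omega> f + emp_mean n Z \<omega> f'"
  by (simp add: emp_mean_def sum.distrib add_divide_distrib)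

lemma emp_mean_diff: "emp_mean n Z \<omega> (\<lambda>z. f z - f' z) = emp_mean n Z \<omega> f - emp_mean n Z \<omega> f'"
  by (simp add: emp_mean_def sum_subtractf diff_divide_distrib)

lemma emp_mean_cmult: "emp_mean n Z \<omega> (\<lambda>z. c * f z) = c * emp_mean n Z \<omega> f"
  by (simp add: emp_mean_def sum_distrib_left)

lemma emp_mean_sum: "emp_mean n Z \<omega> (\<lambda>z. \<Sum>j\<in>J. f j z) = (\<Sum>j\<in>J. emp_mean n Z \<omega> (f j))"
  unfolding emp_mean_def by (subst sum.swap) (simp add: sum_divide_distrib)

lemma emp_mean_cong:
  "(\<And>i. i < n \<Longrightarrow> f (Z i \<omega>) = f' (Z i \<omega>)) \<Longrightarrow> emp_mean n Z \<omega> f = emp_mean n Z \<omega> f'"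
  by (simp add: emp_mean_def)

lemma emp_mean_mono:
  "(\<And>i. i < n \<Longrightarrow> f (Z i \<omega>) \<le> f' (Z i \<omega>)) \<Longrightarrow> emp_mean n Z \<omega> f \<le> emp_mean n Z \<omega> f'"
  unfolding emp_mean_def by (intro divide_right_mono sum_mono) auto

lemma emp_mean_const: "0 < n \<Longrightarrow> emp_mean n Z \<omega> (\<lambda>_. c) = c"
  by (simp add: emp_mean_def)

lemma abs_emp_mean_le:
  assumes "0 < n" "\<And>i. i < n \<Longrightarrow> \<bar>f (Z i \<omega>)\<bar> \<le> c"
  shows "\<bar>emp_mean n Z \<omega> f\<bar> \<le> c"
proof -
  have "\<bar>\<Sum>i<n. f (Z i \<omega>)\<bar> \<le> (\<Sum>i<n. \<bar>f (Z i \<omega>)\<bar>)"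
    by (rule sum_abs)
  also have "\<dots> \<le> (\<Sum>i<n. c)"
    using assms by (intro sum_mono) auto
  finally show ?thesis
    using \<open>0 < n\<close> by (simp add: emp_mean_def field_simps)
qed

text \<open>The norm of a matrix is here the Euclidean norm of its entries (Frobenius), so
  Cauchy-Schwarz applied row by row suffices.\<close>

lemma norm_matrix_vector_mult_le:
  fixes B :: "real^'n^'m"
  shows "norm (B *v v) \<le> norm B * norm v"
proof (rule power2_le_imp_le)
  have "(norm (B *v v))\<^sup>2 = (\<Sum>j\<in>UNIV. (B $ j \<bullet> v)\<^sup>2)"
    unfolding power2_norm_eq_inner inner_vec_def[of "B *v v"] by (simp add: matrix_mult_dot power2_eq_square)
  also have "\<dots> \<le> (\<Sum>j\<in>UNIV. (B $ j \<bullet> B $ j) * (v \<bullet> v))"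
    by (intro sum_mono Cauchy_Schwarz_ineq)
  also have "\<dots> = (norm B * norm v)\<^sup>2"
    unfolding power_mult_distrib power2_norm_eq_inner inner_vec_def[of B] by (simp add: sum_distrib_right)
  finally show "(norm (B *v v))\<^sup>2 \<le> (norm B * norm v)\<^sup>2" .
qed simp

text \<open>The feasible set is cut out by finitely many open conditions, so a short segment through
  \<theta> in direction v stays feasible. The objective restricted to it has a local maximum at 0,
  where its derivative must vanish.\<close>

lemma log_sum_max_stationary:
  fixes g :: "nat \<Rightarrow> 'v::real_inner"
  assumes pos: "\<And>i. i < n \<Longrightarrow> 0 < 1 + g i \<bullet> \<theta>"
    and max: "\<And>\<theta>'. (\<And>i. i < n \<Longrightarrow> 0 < 1 + g i \<bullet> \<theta>') \<Longrightarrow>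
      (\<Sum>i<n. ln (1 + g i \<bullet> \<theta>')) \<le> (\<Sum>i<n. ln (1 + g i \<bullet> \<theta>))"
  shows "(\<Sum>i<n. (g i \<bullet> v) / (1 + g i \<bullet> \<theta>)) = 0"
proof -
  define \<phi> where "\<phi> s = (\<Sum>i<n. ln (1 + g i \<bullet> (\<theta> + s *\<^sub>R v)))" for s :: real
  have eq: "g i \<bullet> (\<theta> + s *\<^sub>R v) = g i \<bullet> \<theta> + s * (g i \<bullet> v)" for i s
    by (simp add: inner_add_right)
  have deriv: "(\<phi> has_real_derivative (\<Sum>i<n. (g i \<bullet> v) / (1 + g i \<bullet> \<theta>))) (at 0)"
    unfolding \<phi>_def eq by (auto intro!: derivative_eq_intros sum.cong dest: pos)
  have "eventually (\<lambda>s::real. \<forall>i\<in>{..<n}. 0 < 1 + g i \<bullet> (\<theta> + s *\<^sub>R v)) (nhds 0)"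
  proof (intro eventually_ball_finite ballI)
    fix i assume "i \<in> {..<n}"
    have "((\<lambda>s. 1 + (g i \<bullet> \<theta> + s * (g i \<bullet> v))) \<longlongrightarrow> 1 + (g i \<bullet> \<theta> + 0 * (g i \<bullet> v))) (nhds 0)"
      by (intro tendsto_intros) (simp add: filterlim_ident)
    then show "eventually (\<lambda>s::real. 0 < 1 + g i \<bullet> (\<theta> + s *\<^sub>R v)) (nhds 0)"
      unfolding eq using pos \<open>i \<in> {..<n}\<close> by (intro order_tendstoD(1)) auto
  qed simp
  then obtain d where d: "0 < d" "\<And>s i. \<bar>s\<bar> < d \<Longrightarrow> i < n \<Longrightarrow> 0 < 1 + g i \<bullet> (\<theta> + s *\<^sub>R v)"
    by (auto simp: eventually_nhds_metric dist_real_def)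
  have "\<phi> s \<le> \<phi> 0" if "\<bar>0 - s\<bar> < d" for s
    using max[of "\<theta> + s *\<^sub>R v"] d(2)[of s] that by (simp add: \<phi>_def)
  then show ?thesis
    using DERIV_local_max[OF deriv \<open>0 < d\<close>] by blast
qed

text \<open>A deterministic estimate at one sample point: the estimator is linear in the data up to
  an error quadratic in the deviations A, B, C of the empirical moments. The hypothesis
  \<open>normal_eq\<close> records the normal equations of the projection tested against \<theta>;
  it removes the one term that is of first order only.\<close>

lemma empirical_likelihood_expansion:
  fixes g :: "'z \<Rightarrow> real^'k" and S :: "real^'k^'k" and b :: "real^'k" and h :: "'z \<Rightarrow> real"
    and n :: nat and Z :: "nat \<Rightarrow> 'w \<Rightarrow> 'z" and \<omega> :: 'w
  defines "E \<equiv> emp_mean n Z \<omega>"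
  defines "A \<equiv> (\<chi> j. E (\<lambda>z. g z $ j))"
    and "B \<equiv> (\<chi> j k. E (\<lambda>z. g z $ j * g z $ k) - S $ j $ k)"
    and "C \<equiv> (\<chi> j. E (\<lambda>z. h z * g z $ j) - b $ j)"
  assumes "0 < n"
    and g: "\<And>i. i < n \<Longrightarrow> norm (g (Z i \<omega>)) \<le> G" and "0 < G"
    and h: "\<And>i. i < n \<Longrightarrow> \<bar>h (Z i \<omega>)\<bar> \<le> K"
    and pos: "\<And>i. i < n \<Longrightarrow> 0 < 1 + g (Z i \<omega>) \<bullet> \<theta>"
    and stat: "\<And>v. E (\<lambda>z. (g z \<bullet> v) / (1 + g z \<bullet> \<theta>)) = 0"
    and "0 < s" and coercive: "s * (\<theta> \<bullet> \<theta>) \<le> \<theta> \<bullet> (S *v \<theta>)"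
    and normal_eq: "\<theta>s \<bullet> (S *v \<theta>) = b \<bullet> \<theta>"
    and B_small: "norm B \<le> s / 4" and A_small: "G * norm A \<le> s / 4"
  shows "\<bar>E (\<lambda>z. h z / (1 + g z \<bullet> \<theta>)) - E (\<lambda>z. h z - g z \<bullet> \<theta>s)\<bar>
    \<le> (2 / s + 2 * norm \<theta>s / s + (K + G * norm \<theta>s) * 8 * G\<^sup>2 / s\<^sup>2)
      * ((norm A)\<^sup>2 + (norm B)\<^sup>2 + (norm C)\<^sup>2)"
proof -
  define \<rho> where "\<rho> = norm \<theta>"
  have EA: "E (\<lambda>z. g z \<bullet> v) = A \<bullet> v" for v
    by (simp add: A_def E_def inner_vec_def emp_mean_sum emp_mean_cmult mult.commute[of _ "v $ _"])
  have EB: "E (\<lambda>z. (g z \<bullet> u) * (g z \<bullet> v)) = u \<bullet> (B *v v) + u \<bullet> (S *v v)" for u v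
  proof -
    have "E (\<lambda>z. (g z \<bullet> u) * (g z \<bullet> v))
        = E (\<lambda>z. \<Sum>j\<in>UNIV. \<Sum>k\<in>UNIV. (u $ j * v $ k) * (g z $ j * g z $ k))"
      by (simp add: inner_vec_def sum_product mult_ac)
    also have "\<dots> = (\<Sum>j\<in>UNIV. \<Sum>k\<in>UNIV. (u $ j * v $ k) * (B $ j $ k + S $ j $ k))"
      unfolding E_def emp_mean_sum emp_mean_cmult B_def by simp
    also have "\<dots> = u \<bullet> (B *v v) + u \<bullet> (S *v v)"
      by (simp add: inner_vec_def matrix_vector_mult_def sum_distrib_left sum.distrib algebra_simps)
    finally show ?thesis .
  qed
  have EC: "E (\<lambda>z. h z * (g z \<bullet> v)) = C \<bullet> v + b \<bullet> v" for v
  proof -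
    have "E (\<lambda>z. h z * (g z \<bullet> v)) = E (\<lambda>z. \<Sum>j\<in>UNIV. v $ j * (h z * g z $ j))"
      by (simp add: inner_vec_def sum_distrib_left mult_ac)
    also have "\<dots> = (\<Sum>j\<in>UNIV. v $ j * (C $ j + b $ j))"
      unfolding E_def emp_mean_sum emp_mean_cmult C_def by simp
    also have "\<dots> = C \<bullet> v + b \<bullet> v"
      by (simp add: inner_vec_def sum.distrib algebra_simps)
    finally show ?thesis .
  qed
  have gv: "\<bar>g (Z i \<omega>) \<bullet> v\<bar> \<le> G * norm v" if "i < n" for i v
  proof -
    have "\<bar>g (Z i \<omega>) \<bullet> v\<bar> \<le> norm (g (Z i \<omega>)) * norm v"
      by (rule Cauchy_Schwarz_ineq2)
    also have "\<dots> \<le> G * norm v"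
      using g[OF that] by (rule mult_right_mono) simp
    finally show ?thesis .
  qed
  have uBv: "\<bar>u \<bullet> (B *v v)\<bar> \<le> norm u * (norm B * norm v)" for u v
    by (rule order_trans[OF Cauchy_Schwarz_ineq2]) (intro mult_left_mono norm_matrix_vector_mult_le norm_ge_zero)

  \<comment> \<open>Owen's bound: stationarity in the direction \<open>\<theta>\<close> itself controls the size of \<open>\<theta>\<close>.\<close>
  have \<rho>_le: "\<rho> \<le> 2 * norm A / s"
  proof (cases "\<rho> = 0")
    case False
    then have "0 < \<rho>" by (simp add: \<rho>_def)
    have G\<rho>: "0 < 1 + G * \<rho>"
      using \<open>0 < G\<close> \<open>0 < \<rho>\<close> by (simp add: add_pos_pos)
    \<comment> \<open>With y standing for \<open>g z \<bullet> \<theta>\<close>: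
      \<open>y - y / (1 + y) = y * y / (1 + y)\<close>, and
      \<open>1 + y \<le> 1 + G * \<rho>\<close>. The average of \<open>y / (1 + y)\<close> is 0 by
      stationarity, which leaves \<open>A \<bullet> \<theta>\<close> as upper bound.\<close>
    have "E (\<lambda>z. (g z \<bullet> \<theta>) * (g z \<bullet> \<theta>)) / (1 + G * \<rho>) = E (\<lambda>z. 1 / (1 + G * \<rho>) * ((g z \<bullet> \<theta>) * (g z \<bullet> \<theta>)))"
      unfolding E_def emp_mean_cmult by simp
    also have "\<dots> \<le> E (\<lambda>z. (g z \<bullet> \<theta>) - (g z \<bullet> \<theta>) / (1 + g z \<bullet> \<theta>))"
      unfolding E_def
    proof (rule emp_mean_mono)
      fix i assume i: "i < n"
      let ?y = "g (Z i \<omega>) \<bullet> \<theta>"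
      have y: "0 < 1 + ?y" "?y \<le> G * \<rho>"
        using pos[OF i] gv[OF i, of \<theta>] by (auto simp: \<rho>_def)
      have "1 / (1 + G * \<rho>) * (?y * ?y) \<le> 1 / (1 + ?y) * (?y * ?y)"
        using y G\<rho> by (intro mult_right_mono divide_left_mono) auto
      also have "\<dots> = ?y - ?y / (1 + ?y)"
        using y by (simp add: field_simps)
      finally show "1 / (1 + G * \<rho>) * (?y * ?y) \<le> ?y - ?y / (1 + ?y)" .
    qed
    also have "\<dots> = A \<bullet> \<theta>"
      using stat[of \<theta>] EA[of \<theta>] by (simp add: E_def emp_mean_diff)
    also have "\<dots> \<le> norm A * \<rho>"
      unfolding \<rho>_def by (rule norm_cauchy_schwarz)
    finally have 1: "E (\<lambda>z. (g z \<bullet> \<theta>) * (g z \<bullet> \<theta>)) \<le> norm A * \<rho> * (1 + G * \<rho>)"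
      using G\<rho> by (simp add: field_simps)
    \<comment> \<open>Smallness of B costs a quarter of the curvature s. Smallness of A absorbs the
      term with \<open>G * \<rho>\<close> at the cost of another quarter, leaving
      \<open>s / 2 * \<rho> \<le> norm A\<close>.\<close>
    have "norm B * \<rho>\<^sup>2 \<le> s / 4 * \<rho>\<^sup>2"
      using B_small by (rule mult_right_mono) simp
    moreover have "\<bar>\<theta> \<bullet> (B *v \<theta>)\<bar> \<le> norm B * \<rho>\<^sup>2"
      using uBv[of \<theta> \<theta>] by (simp add: \<rho>_def power2_eq_square mult_ac)
    moreover have "s * \<rho>\<^sup>2 \<le> \<theta> \<bullet> (S *v \<theta>)"
      using coercive by (simp add: \<rho>_def power2_norm_eq_inner)
    ultimately have "3 / 4 * s * \<rho>\<^sup>2 \<le> norm A * \<rho> * (1 + G * \<rho>)"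
      using 1 unfolding EB by linarith
    then have "(3 / 4 * s * \<rho>) * \<rho> \<le> (norm A * (1 + G * \<rho>)) * \<rho>"
      unfolding power2_eq_square by (simp only: mult_ac)
    then have "3 / 4 * s * \<rho> \<le> norm A * (1 + G * \<rho>)"
      using \<open>0 < \<rho>\<close> by (rule mult_right_le_imp_le)
    moreover have "(G * norm A) * \<rho> \<le> s / 4 * \<rho>"
      using A_small \<open>0 < \<rho>\<close> by (intro mult_right_mono) auto
    ultimately have "s * \<rho> \<le> 2 * norm A"
      by (simp add: algebra_simps)
    then show ?thesis
      using \<open>0 < s\<close> by (simp add: field_simps)
  qed (use \<open>0 < s\<close> in simp)
  have "0 \<le> \<rho>" by (simp add: \<rho>_def)
  \<comment> \<open>This bound keeps every denominator \<open>1 + g z \<bullet> \<theta>\<close> at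
    the data points above 1/2, so the remainder R is of order \<open>\<rho>\<^sup>2\<close>.\<close>
  have "G * \<rho> \<le> G * (2 * norm A / s)"
    using \<rho>_le \<open>0 < G\<close> by (intro mult_left_mono) auto
  also have "\<dots> \<le> 1 / 2"
    using A_small \<open>0 < s\<close> by (simp add: field_simps)
  finally have G\<rho>: "G * \<rho> \<le> 1 / 2" .

  define R where "R z = (g z \<bullet> \<theta>)\<^sup>2 / (1 + g z \<bullet> \<theta>)" for z
  have R: "\<bar>R (Z i \<omega>)\<bar> \<le> 2 * G\<^sup>2 * \<rho>\<^sup>2" if i: "i < n" for i
  proof -
    let ?y = "g (Z i \<omega>) \<bullet> \<theta>"
    have y: "\<bar>?y\<bar> \<le> G * \<rho>"
      using gv[OF i, of \<theta>] by (simp add: \<rho>_def)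
    then have "1 / 2 \<le> 1 + ?y"
      using G\<rho> by linarith
    then have "\<bar>R (Z i \<omega>)\<bar> \<le> ?y\<^sup>2 / (1 / 2)"
      unfolding R_def by (simp add: divide_left_mono del: divide_divide_eq_right)
    also have "?y\<^sup>2 \<le> (G * \<rho>)\<^sup>2"
      using y \<open>0 < G\<close> \<open>0 \<le> \<rho>\<close> by (simp add: abs_le_square_iff[symmetric])
    finally show ?thesis
      by (simp add: power_mult_distrib)
  qed
  have expand: "f z / (1 + g z \<bullet> \<theta>) = f z - f z * (g z \<bullet> \<theta>) + f z * R z" if "0 < 1 + g z \<bullet> \<theta>" for f z
    using that by (simp add: R_def field_simps power2_eq_square)
  have E_expand: "E (\<lambda>z. f z / (1 + g z \<bullet> \<theta>)) = E f - E (\<lambda>z. f z * (g z \<bullet> \<theta>)) + E (\<lambda>z. f z * R z)" for f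
  proof -
    have "E (\<lambda>z. f z / (1 + g z \<bullet> \<theta>)) = E (\<lambda>z. f z - f z * (g z \<bullet> \<theta>) + f z * R z)"
      unfolding E_def using pos by (intro emp_mean_cong expand)
    then show ?thesis
      by (simp add: E_def emp_mean_add emp_mean_diff)
  qed
  have ER: "\<bar>E (\<lambda>z. f z * R z)\<bar> \<le> c * (2 * G\<^sup>2 * \<rho>\<^sup>2)" if "\<And>i. i < n \<Longrightarrow> \<bar>f (Z i \<omega>)\<bar> \<le> c" for f c
    unfolding E_def
  proof (rule abs_emp_mean_le[OF \<open>0 < n\<close>])
    fix i assume i: "i < n"
    then have "0 \<le> c" using that[OF i] by linarith
    then show "\<bar>f (Z i \<omega>) * R (Z i \<omega>)\<bar> \<le> c * (2 * G\<^sup>2 * \<rho>\<^sup>2)"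
      unfolding abs_mult using that[OF i] R[OF i] by (intro mult_mono) auto
  qed
  have "E (\<lambda>z. h z / (1 + g z \<bullet> \<theta>)) - E (\<lambda>z. h z - g z \<bullet> \<theta>s)
      = E (\<lambda>z. (g z \<bullet> \<theta>s)) - C \<bullet> \<theta> - b \<bullet> \<theta> + E (\<lambda>z. h z * R z)"
    unfolding E_expand EC by (simp add: E_def emp_mean_diff)
  \<comment> \<open>Stationarity in the direction \<open>\<theta>s\<close>, expanded to second
    order. The term \<open>b \<bullet> \<theta>\<close> produced here cancels the one coming from h;
    everything left is quadratically small.\<close>
  also have "E (\<lambda>z. (g z \<bullet> \<theta>s)) = \<theta>s \<bullet> (B *v \<theta>) + b \<bullet> \<theta> - E (\<lambda>z. (g z \<bullet> \<theta>s) * R z)"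
    using stat[of \<theta>s] unfolding E_expand EB normal_eq by simp
  finally have "\<bar>E (\<lambda>z. h z / (1 + g z \<bullet> \<theta>)) - E (\<lambda>z. h z - g z \<bullet> \<theta>s)\<bar>
      \<le> \<bar>C \<bullet> \<theta>\<bar> + \<bar>\<theta>s \<bullet> (B *v \<theta>)\<bar> + \<bar>E (\<lambda>z. h z * R z)\<bar> + \<bar>E (\<lambda>z. (g z \<bullet> \<theta>s) * R z)\<bar>"
    by linarith
  also have "\<dots> \<le> norm C * \<rho> + norm \<theta>s * (norm B * \<rho>) + K * (2 * G\<^sup>2 * \<rho>\<^sup>2) + (G * norm \<theta>s) * (2 * G\<^sup>2 * \<rho>\<^sup>2)"
    unfolding \<rho>_def
    by (intro add_mono Cauchy_Schwarz_ineq2 uBv ER[unfolded \<rho>_def] h gv)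
  also have "\<dots> = norm C * \<rho> + norm \<theta>s * (norm B * \<rho>) + (K + G * norm \<theta>s) * (2 * G\<^sup>2 * \<rho>\<^sup>2)"
    by (simp add: algebra_simps)
  \<comment> \<open>Each factor \<rho> is replaced by \<open>2 * norm A / s\<close>, and products of
    two deviations are bounded by the sum of the squares.\<close>
  also have "\<dots> \<le> 2 / s * ((norm A)\<^sup>2 + (norm B)\<^sup>2 + (norm C)\<^sup>2)
      + 2 * norm \<theta>s / s * ((norm A)\<^sup>2 + (norm B)\<^sup>2 + (norm C)\<^sup>2)
      + (K + G * norm \<theta>s) * 8 * G\<^sup>2 / s\<^sup>2 * ((norm A)\<^sup>2 + (norm B)\<^sup>2 + (norm C)\<^sup>2)"
    (is "_ \<le> 2 / s * ?D + _ + _")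
  proof (intro add_mono)
    have prod_le: "a * norm A \<le> ?D" if "a = norm B \<or> a = norm C" for a
    proof -
      have "2 * (a * norm A) \<le> a\<^sup>2 + (norm A)\<^sup>2"
        using sum_squares_bound[of a "norm A"] by simp
      moreover have "a\<^sup>2 \<le> (norm B)\<^sup>2 + (norm C)\<^sup>2" "0 \<le> (norm A)\<^sup>2" "0 \<le> (norm B)\<^sup>2" "0 \<le> (norm C)\<^sup>2"
        using that by auto
      ultimately show ?thesis by linarith
    qed
    have *: "a * \<rho> \<le> 2 / s * ?D" if "a = norm B \<or> a = norm C" for a
    proof -
      have "a * \<rho> \<le> a * (2 * norm A / s)"
        using that by (intro mult_left_mono \<rho>_le) auto
      also have "\<dots> = 2 / s * (a * norm A)" by simp
      also have "\<dots> \<le> 2 / s * ?D"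
        using prod_le[OF that] \<open>0 < s\<close> by (intro mult_left_mono) auto
      finally show ?thesis .
    qed
    show "norm C * \<rho> \<le> 2 / s * ?D" by (rule *) simp
    have "norm \<theta>s * (norm B * \<rho>) \<le> norm \<theta>s * (2 / s * ?D)"
      by (intro mult_left_mono *) auto
    then show "norm \<theta>s * (norm B * \<rho>) \<le> 2 * norm \<theta>s / s * ?D" by (simp add: mult_ac)
    have "0 \<le> K"
      using h[OF \<open>0 < n\<close>] by linarith
    have "\<rho>\<^sup>2 \<le> (2 * norm A / s)\<^sup>2"
      using \<rho>_le \<open>0 \<le> \<rho>\<close> by (rule power_mono)
    also have "\<dots> = 4 / s\<^sup>2 * (norm A)\<^sup>2"
      by (simp add: power_mult_distrib power_divide)
    also have "\<dots> \<le> 4 / s\<^sup>2 * ?D"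
      by (intro mult_left_mono) auto
    finally have "(K + G * norm \<theta>s) * (2 * G\<^sup>2 * \<rho>\<^sup>2) \<le> (K + G * norm \<theta>s) * (2 * G\<^sup>2 * (4 / s\<^sup>2 * ?D))"
      using \<open>0 < G\<close> \<open>0 \<le> K\<close> by (intro mult_left_mono) auto
    then show "(K + G * norm \<theta>s) * (2 * G\<^sup>2 * \<rho>\<^sup>2) \<le> (K + G * norm \<theta>s) * 8 * G\<^sup>2 / s\<^sup>2 * ?D"
      by (simp add: algebra_simps add_divide_distrib)
  qed
  finally show ?thesis
    by (simp add: distrib_right)
qed

subsection \<open>Asymptotics for independent samples\<close>

lemma power2_norm_vec: "(norm v)\<^sup>2 = (\<Sum>j\<in>UNIV. (v $ j)\<^sup>2)" for v :: "real^'n"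
  unfolding power2_norm_eq_inner inner_vec_def by (simp add: power2_eq_square)

lemma power2_norm_matrix: "(norm B)\<^sup>2 = (\<Sum>j\<in>UNIV. \<Sum>k\<in>UNIV. (B $ j $ k)\<^sup>2)" for B :: "real^'n^'m"
  unfolding power2_norm_eq_inner inner_vec_def by (simp add: power2_eq_square)

text \<open>The constant s is the minimum of the quadratic form on the compact unit sphere;
  homogeneity carries the bound to all vectors.\<close>

lemma positive_definite_coercive:
  fixes S :: "real^'n^'n"
  assumes "\<And>u. u \<noteq> 0 \<Longrightarrow> 0 < u \<bullet> (S *v u)"
  obtains s where "0 < s" "\<And>u. s * (u \<bullet> u) \<le> u \<bullet> (S *v u)"
proof -
  have "continuous_on (sphere (0::real^'n) 1) (\<lambda>u. u \<bullet> (S *v u))"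
    by (intro continuous_intros)
  moreover have "sphere (0::real^'n) 1 \<noteq> {}"
    by simp
  ultimately have "\<exists>u0\<in>sphere 0 1. \<forall>u\<in>sphere 0 1. u0 \<bullet> (S *v u0) \<le> u \<bullet> (S *v u)"
    by (intro continuous_attains_inf compact_sphere)
  then obtain u0 where u0: "u0 \<in> sphere 0 1" "\<And>u. u \<in> sphere 0 1 \<Longrightarrow> u0 \<bullet> (S *v u0) \<le> u \<bullet> (S *v u)"
    by blast
  show thesis
  proof
    show "0 < u0 \<bullet> (S *v u0)"
      using u0(1) by (intro assms) auto
    show "u0 \<bullet> (S *v u0) * (u \<bullet> u) \<le> u \<bullet> (S *v u)" for u
    proof (cases "u = 0")
      case False
      let ?u = "inverse (norm u) *\<^sub>R u"
      have "u0 \<bullet> (S *v u0) \<le> ?u \<bullet> (S *v ?u)"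
        using False by (intro u0(2)) simp
      also have "\<dots> = (u \<bullet> (S *v u)) / (u \<bullet> u)"
        by (simp add: matrix_vector_mult_scaleR divide_inverse power2_eq_square flip: power2_norm_eq_inner)
      finally show ?thesis
        using False by (simp add: pos_le_divide_eq)
    qed simp
  qed
qed

section \<open>Least squares projection of a bounded response\<close>

locale bounded_regression = prob_space Q for Q :: "'z measure" +
  fixes g :: "'z \<Rightarrow> real^'k" and h :: "'z \<Rightarrow> real" and G K :: real
  assumes g_meas [measurable]: "g \<in> borel_measurable Q" and h_meas [measurable]: "h \<in> borel_measurable Q"
    and g_bdd: "AE z in Q. norm (g z) \<le> G"
    and h_bdd: "AE z in Q. \<bar>h z\<bar> \<le> K"
begin

definition gram_matrix :: "real^'k^'k" where
  "gram_matrix = (\<chi> j k. \<integral>z. g z $ j * g z $ k \<partial>Q)"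

lemma g_nth_meas [measurable]: "(\<lambda>z. g z $ j) \<in> borel_measurable Q"
  using borel_measurable_inner[OF g_meas borel_measurable_const, of "axis j 1"] by (simp add: inner_axis)

lemma AE_abs_mult_le:
  fixes f f' :: "'z \<Rightarrow> real"
  assumes "AE z in Q. \<bar>f z\<bar> \<le> c" "AE z in Q. \<bar>f' z\<bar> \<le> c'"
  shows "AE z in Q. \<bar>f z * f' z\<bar> \<le> c * c'"
  using assms
proof eventually_elim
  case (elim z)
  then show ?case
    unfolding abs_mult by (intro mult_mono) auto
qed

lemma AE_abs_inner_le: "AE z in Q. \<bar>g z \<bullet> u\<bar> \<le> G * norm u"
  using g_bdd
proof eventually_elim
  case (elim z)
  then have "norm (g z) * norm u \<le> G * norm u"
    by (intro mult_right_mono) auto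
  then show ?case
    using Cauchy_Schwarz_ineq2[of "g z" u] by linarith
qed

lemma AE_abs_nth_le: "AE z in Q. \<bar>g z $ j\<bar> \<le> G"
  using AE_abs_inner_le[of "axis j 1"] by (simp add: inner_axis)

lemma integrable_bounded:
  fixes f :: "'z \<Rightarrow> real"
  assumes "f \<in> borel_measurable Q" "AE z in Q. \<bar>f z\<bar> \<le> c"
  shows "integrable Q f"
  using assms by (intro integrable_const_bound[where B = c]) auto

lemma integrable_bounded_sq:
  fixes f :: "'z \<Rightarrow> real"
  assumes [measurable]: "f \<in> borel_measurable Q" and bdd: "AE z in Q. \<bar>f z\<bar> \<le> c"
  shows "integrable Q (\<lambda>z. (f z - a)\<^sup>2)"
proof -
  have "AE z in Q. \<bar>f z - a\<bar> \<le> c + \<bar>a\<bar>"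
    using bdd by eventually_elim linarith
  from AE_abs_mult_le[OF this this] show ?thesis
    unfolding power2_eq_square by (intro integrable_bounded) auto
qed

lemma AE_abs_residual_le: "AE z in Q. \<bar>h z - g z \<bullet> u\<bar> \<le> K + G * norm u"
  using h_bdd AE_abs_inner_le[of u] by eventually_elim linarith

text \<open>All these functions are built from almost everywhere bounded ones by sums and products,
  hence are almost everywhere bounded and integrable under a probability measure.\<close>

lemma
  shows integrable_h: "integrable Q h"
    and integrable_nth: "integrable Q (\<lambda>z. g z $ j)"
    and integrable_nth_mult: "integrable Q (\<lambda>z. g z $ j * g z $ k)"
    and integrable_h_mult_nth: "integrable Q (\<lambda>z. h z * g z $ j)"
    and integrable_inner: "integrable Q (\<lambda>z. g z \<bullet> u)"
    and integrable_inner_mult: "integrable Q (\<lambda>z. (g z \<bullet> u) * (g z \<bullet> v))"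
    and integrable_inner_mult_nth: "integrable Q (\<lambda>z. (g z \<bullet> u) * g z $ j)"
    and integrable_residual: "integrable Q (\<lambda>z. h z - g z \<bullet> u)"
    and integrable_residual_sq: "integrable Q (\<lambda>z. (h z - g z \<bullet> u)\<^sup>2)"
    and integrable_residual_mult: "integrable Q (\<lambda>z. (h z - g z \<bullet> u) * (g z \<bullet> v))"
  using h_bdd AE_abs_nth_le[of j] AE_abs_inner_le[of u]
    AE_abs_mult_le[OF AE_abs_nth_le AE_abs_nth_le, of j k] AE_abs_mult_le[OF h_bdd AE_abs_nth_le, of j]
    AE_abs_mult_le[OF AE_abs_inner_le AE_abs_inner_le, of u v] AE_abs_mult_le[OF AE_abs_inner_le AE_abs_nth_le, of u j]
    AE_abs_residual_le[of u] AE_abs_mult_le[OF AE_abs_residual_le AE_abs_inner_le, of u v]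
    integrable_bounded_sq[OF _ AE_abs_residual_le, of u 0]
  by (auto intro: integrable_bounded)

lemma inner_gram_matrix: "u \<bullet> (gram_matrix *v v) = (\<integral>z. (g z \<bullet> u) * (g z \<bullet> v) \<partial>Q)"
proof -
  have "(\<integral>z. (g z \<bullet> u) * (g z \<bullet> v) \<partial>Q) = (\<integral>z. (\<Sum>j\<in>UNIV. \<Sum>k\<in>UNIV. (u $ j * v $ k) * (g z $ j * g z $ k)) \<partial>Q)"
    by (simp add: inner_vec_def sum_product mult_ac)
  also have "\<dots> = (\<Sum>j\<in>UNIV. \<Sum>k\<in>UNIV. (u $ j * v $ k) * gram_matrix $ j $ k)"
    using integrable_nth_mult by (simp add: gram_matrix_def Bochner_Integration.integral_sum)
  also have "\<dots> = u \<bullet> (gram_matrix *v v)"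
    by (simp add: inner_vec_def matrix_vector_mult_def sum_distrib_left mult_ac)
  finally show ?thesis ..
qed

text \<open>If the quadratic form vanished at u, then \<open>g z \<bullet> u\<close> would be 0
  almost everywhere, hence \<open>gram_matrix *v u\<close> orthogonal to every v and so 0, against
  injectivity.\<close>

lemma gram_matrix_positive_definite:
  assumes "invertible gram_matrix" and "u \<noteq> 0"
  shows "0 < u \<bullet> (gram_matrix *v u)"
proof (rule ccontr)
  assume "\<not> 0 < u \<bullet> (gram_matrix *v u)"
  moreover have "0 \<le> u \<bullet> (gram_matrix *v u)"
    unfolding inner_gram_matrix by simp
  ultimately have "u \<bullet> (gram_matrix *v u) = 0"
    by linarith
  then have "(\<integral>z. (g z \<bullet> u) * (g z \<bullet> u) \<partial>Q) = 0"
    by (simp only: inner_gram_matrix)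
  then have "AE z in Q. (g z \<bullet> u) * (g z \<bullet> u) = 0"
    by (subst (asm) integral_nonneg_eq_0_iff_AE[OF integrable_inner_mult]) auto
  then have "AE z in Q. (g z \<bullet> v) * (g z \<bullet> u) = 0" for v
    by auto
  then have "v \<bullet> (gram_matrix *v u) = 0" for v
    unfolding inner_gram_matrix by (intro integral_eq_zero_AE)
  then have "gram_matrix *v u = 0"
    by (metis inner_eq_zero_iff)
  then show False
    using assms by (metis invertible_left_inverse matrix_left_invertible_ker)
qed

text \<open>Turns orthogonality of the residual to the coordinates of g into the normal equations
  for u.\<close>

lemma integral_residual_mult_nth:
  "(\<integral>z. (h z - g z \<bullet> u) * g z $ j \<partial>Q) = (\<integral>z. h z * g z $ j \<partial>Q) - (gram_matrix *v u) $ j"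
proof -
  have "(gram_matrix *v u) $ j = (\<integral>z. (g z \<bullet> u) * g z $ j \<partial>Q)"
    using inner_gram_matrix[of "axis j 1" u] by (simp add: inner_axis inner_axis' mult.commute)
  then show ?thesis
    using integrable_h_mult_nth integrable_inner_mult_nth by (simp add: left_diff_distrib)
qed

text \<open>The inverse Gram matrix applied to the vector b of moments of
  \<open>h z * g z $ j\<close> solves the normal equations.\<close>

lemma ex_projection:
  assumes "invertible gram_matrix"
  shows "\<exists>u. \<forall>j. (\<integral>z. (h z - g z \<bullet> u) * g z $ j \<partial>Q) = 0"
proof -
  define b where "b = (\<chi> j. \<integral>z. h z * g z $ j \<partial>Q)"
  obtain S' where "gram_matrix ** S' = mat 1"
    using assms by (auto simp: invertible_def)
  then have "gram_matrix *v (S' *v b) = b"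
    by (simp add: matrix_vector_mul_assoc)
  then have "\<forall>j. (\<integral>z. (h z - g z \<bullet> (S' *v b)) * g z $ j \<partial>Q) = 0"
    by (simp add: integral_residual_mult_nth b_def)
  then show ?thesis ..
qed

text \<open>Pythagoras: \<open>h z - g z \<bullet> v\<close> is the residual at u plus
  \<open>g z \<bullet> (u - v)\<close>, and the cross term integrates to 0.\<close>

lemma projection_minimal:
  assumes orth: "\<And>j. (\<integral>z. (h z - g z \<bullet> u) * g z $ j \<partial>Q) = 0"
  shows "(\<integral>z. (h z - g z \<bullet> u)\<^sup>2 \<partial>Q) \<le> (\<integral>z. (h z - g z \<bullet> v)\<^sup>2 \<partial>Q)"
proof -
  have int: "integrable Q (\<lambda>z. (h z - g z \<bullet> u) * g z $ j)" for j
    using integrable_residual_mult[of u "axis j 1"] by (simp add: inner_axis)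
  have "(\<integral>z. (h z - g z \<bullet> u) * (g z \<bullet> (u - v)) \<partial>Q) = (\<integral>z. (\<Sum>j\<in>UNIV. (u - v) $ j * ((h z - g z \<bullet> u) * g z $ j)) \<partial>Q)"
    by (simp add: inner_vec_def[of _ "u - v"] sum_distrib_left mult_ac)
  also have "\<dots> = 0"
    using orth int by (simp add: Bochner_Integration.integral_sum)
  finally have cross: "(\<integral>z. (h z - g z \<bullet> u) * (g z \<bullet> (u - v)) \<partial>Q) = 0" .
  have "(\<integral>z. (h z - g z \<bullet> v)\<^sup>2 \<partial>Q)
      = (\<integral>z. (h z - g z \<bullet> u)\<^sup>2 + 2 * ((h z - g z \<bullet> u) * (g z \<bullet> (u - v))) + (g z \<bullet> (u - v)) * (g z \<bullet> (u - v)) \<partial>Q)"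
    by (rule Bochner_Integration.integral_cong) (simp_all add: inner_diff_right power2_eq_square algebra_simps)
  also have "\<dots> = (\<integral>z. (h z - g z \<bullet> u)\<^sup>2 \<partial>Q) + (\<integral>z. (g z \<bullet> (u - v)) * (g z \<bullet> (u - v)) \<partial>Q)"
    using cross integrable_residual_sq integrable_residual_mult integrable_inner_mult by simp
  finally show ?thesis
    by simp
qed

end

section \<open>Empirical means of an i.i.d. sample\<close>

locale iid_sample = prob_space M for M :: "'w measure" +
  fixes N Q :: "'z measure" and Z :: "nat \<Rightarrow> 'w \<Rightarrow> 'z"
  assumes Z_indep: "indep_vars (\<lambda>_. N) Z UNIV"
    and Z_dist: "\<And>i. distr M N (Z i) = Q"
begin

lemma Z_measurable [measurable]: "Z i \<in> measurable M N"
  using Z_indep unfolding indep_vars_def2 by simp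

lemma sets_Q [measurable_cong]: "sets Q = sets N"
  using Z_dist[of 0] by (metis sets_distr)

lemma prob_space_Q: "prob_space Q"
  using prob_space_distr[OF Z_measurable, of 0] unfolding Z_dist .

lemma
  fixes f :: "'z \<Rightarrow> real"
  assumes "f \<in> borel_measurable N"
  shows expectation_sample: "expectation (\<lambda>\<omega>. f (Z i \<omega>)) = (\<integral>z. f z \<partial>Q)"
    and integrable_sample: "integrable M (\<lambda>\<omega>. f (Z i \<omega>)) \<longleftrightarrow> integrable Q f"
  using assms by (auto simp flip: Z_dist[of i] simp: integral_distr integrable_distr_eq)

text \<open>There are countably many observations, so a single null set serves for all of
  them.\<close>

lemma AE_sample:
  assumes "AE z in Q. P z"
  shows "AE \<omega> in M. \<forall>i. P (Z i \<omega>)"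
  unfolding AE_all_countable
proof
  fix i
  have "AE z in distr M N (Z i). P z"
    using assms unfolding Z_dist .
  then show "AE \<omega> in M. P (Z i \<omega>)"
    by (rule AE_distrD[OF Z_measurable])
qed

lemma emp_mean_measurable [measurable]:
  assumes [measurable]: "f \<in> borel_measurable N"
  shows "(\<lambda>\<omega>. emp_mean n Z \<omega> f) \<in> borel_measurable M"
  unfolding emp_mean_def by measurable

lemma
  fixes f :: "'z \<Rightarrow> real"
  assumes f [measurable]: "f \<in> borel_measurable N"
    and sq: "integrable Q (\<lambda>z. (f z)\<^sup>2)" and mean: "(\<integral>z. f z \<partial>Q) = 0"
  shows integrable_emp_mean_sq: "integrable M (\<lambda>\<omega>. (emp_mean n Z \<omega> f)\<^sup>2)"
    and expectation_emp_mean_sq: "expectation (\<lambda>\<omega>. (emp_mean n Z \<omega> f)\<^sup>2) = (\<integral>z. (f z)\<^sup>2 \<partial>Q) / n"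
    and weak_conv_sum_sample:
      "weak_conv_m (\<lambda>n. distr M borel (\<lambda>\<omega>. (\<Sum>i<n. f (Z i \<omega>)) / sqrt n)) (normal_law (\<integral>z. (f z)\<^sup>2 \<partial>Q))"
proof -
  have indep: "indep_vars (\<lambda>_. borel) (\<lambda>i \<omega>. f (Z i \<omega>)) UNIV"
    using Z_indep by (rule indep_vars_compose2) simp
  have m: "expectation (\<lambda>\<omega>. f (Z i \<omega>)) = 0" for i
    by (simp add: expectation_sample[OF f] mean)
  have i: "integrable M (\<lambda>\<omega>. (f (Z i \<omega>))\<^sup>2)" for i
    using sq by (subst integrable_sample) auto
  have v: "expectation (\<lambda>\<omega>. (f (Z i \<omega>))\<^sup>2) = (\<integral>z. (f z)\<^sup>2 \<partial>Q)" for i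
    by (subst expectation_sample[of "\<lambda>z. (f z)\<^sup>2"]) auto
  have eq: "(emp_mean n Z \<omega> f)\<^sup>2 = (\<Sum>i<n. f (Z i \<omega>))\<^sup>2 / (real n)\<^sup>2" for \<omega>
    by (simp add: emp_mean_def power_divide)
  show "integrable M (\<lambda>\<omega>. (emp_mean n Z \<omega> f)\<^sup>2)"
    unfolding eq using second_moment_sum_indep(1)[OF indep m i] by simp
  show "expectation (\<lambda>\<omega>. (emp_mean n Z \<omega> f)\<^sup>2) = (\<integral>z. (f z)\<^sup>2 \<partial>Q) / n"
    unfolding eq using second_moment_sum_indep(2)[OF indep m i, of n]
    by (simp add: v) (simp add: power2_eq_square)
  have "distr M borel (\<lambda>\<omega>. f (Z i \<omega>)) = distr Q borel f" for i
    using distr_distr[OF f Z_measurable, of i] Z_dist[of i] by (simp add: comp_def)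
  then show "weak_conv_m (\<lambda>n. distr M borel (\<lambda>\<omega>. (\<Sum>i<n. f (Z i \<omega>)) / sqrt n)) (normal_law (\<integral>z. (f z)\<^sup>2 \<partial>Q))"
    using indep m i v by (intro central_limit_theorem_normal_law)
qed

text \<open>On \<open>Ev n\<close> the deterministic expansion applies once the deviations are
  small, with error at most a constant times their squared size. That size has expectation of order
  1/n, so by Markov's inequality it stays negligible after multiplication by \<open>sqrt n\<close>,
  and the limit law is that of the linear part. Off \<open>Ev n\<close>, an event of vanishing
  probability, the values of \<theta> are arbitrary.\<close>

theorem empirical_likelihood_weak_conv:
  fixes g :: "'z \<Rightarrow> real^'k" and h :: "'z \<Rightarrow> real" and \<theta> :: "nat \<Rightarrow> 'w \<Rightarrow> real^'k"
    and Ev :: "nat \<Rightarrow> 'w set"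
  defines "\<beta> \<equiv> \<integral>z. h z \<partial>Q"
    and "est \<equiv> \<lambda>n \<omega>. emp_mean n Z \<omega> (\<lambda>z. h z /
      (emp_mean n Z \<omega> (\<lambda>z. 1 / (1 + g z \<bullet> \<theta> n \<omega>)) * (1 + g z \<bullet> \<theta> n \<omega>)))"
  assumes g_meas [measurable]: "g \<in> borel_measurable N" and h_meas [measurable]: "h \<in> borel_measurable N"
    and g_bdd: "\<And>z. z \<in> space N \<Longrightarrow> norm (g z) \<le> G"
    and h_bdd: "AE z in Q. \<bar>h z\<bar> \<le> K"
    and g_mean: "\<And>j. (\<integral>z. g z $ j \<partial>Q) = 0"
    and S_inv: "invertible (\<chi> j k. \<integral>z. g z $ j * g z $ k \<partial>Q)"
    and orth: "\<And>j. (\<integral>z. (h z - g z \<bullet> \<theta>s) * g z $ j \<partial>Q) = 0"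
    and \<theta>_meas [measurable]: "\<And>n. \<theta> n \<in> borel_measurable M"
    and Ev_sets [measurable]: "\<And>n. Ev n \<in> sets M"
    and Ev_prob: "(\<lambda>n. prob (Ev n)) \<longlonglongrightarrow> 1"
    and Ev_pos: "\<And>n \<omega> i. \<omega> \<in> Ev n \<Longrightarrow> i < n \<Longrightarrow> 0 < 1 + g (Z i \<omega>) \<bullet> \<theta> n \<omega>"
    and Ev_max: "\<And>n \<omega> \<theta>'. \<omega> \<in> Ev n \<Longrightarrow> (\<And>i. i < n \<Longrightarrow> 0 < 1 + g (Z i \<omega>) \<bullet> \<theta>') \<Longrightarrow>
      (\<Sum>i<n. ln (1 + g (Z i \<omega>) \<bullet> \<theta>')) \<le> (\<Sum>i<n. ln (1 + g (Z i \<omega>) \<bullet> \<theta> n \<omega>))"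
  shows "weak_conv_m (\<lambda>n. distr M borel (\<lambda>\<omega>. sqrt n * (est n \<omega> - \<beta>)))
    (normal_law ((\<integral>z. (h z - g z \<bullet> \<theta>s)\<^sup>2 \<partial>Q) - \<beta>\<^sup>2))"
proof -
  \<comment> \<open>Enlarges the bound on g to a strictly positive one, as the expansion
    requires.\<close>
  define L where "L = \<bar>G\<bar> + 1"
  have "0 < L" by (simp add: L_def)
  have g_le: "norm (g z) \<le> L" if "z \<in> space N" for z
    using g_bdd[OF that] by (simp add: L_def)
  interpret Q: prob_space Q by (rule prob_space_Q)
  interpret Q: bounded_regression Q g h L K
  proof
    show "AE z in Q. norm (g z) \<le> L"
      using g_le by (auto simp: sets_eq_imp_space_eq[OF sets_Q])
  qed (use h_bdd in measurable)
  define S where "S = Q.gram_matrix"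
  have [measurable]: "(\<lambda>z. g z $ j) \<in> borel_measurable N" for j
    using Q.g_nth_meas by measurable
  have "0 < u \<bullet> (S *v u)" if "u \<noteq> 0" for u
    using Q.gram_matrix_positive_definite S_inv that by (simp add: S_def Q.gram_matrix_def)
  then obtain s where "0 < s" and coercive: "\<And>u. s * (u \<bullet> u) \<le> u \<bullet> (S *v u)"
    using positive_definite_coercive by blast

  define b where "b = (\<chi> j. \<integral>z. h z * g z $ j \<partial>Q)"
  have normal_eq: "\<theta>s \<bullet> (S *v u) = b \<bullet> u" for u
  proof -
    \<comment> \<open>Orthogonality of the residual is the system of normal equations; symmetry of S
      then moves S to the other argument.\<close>
    have "S *v \<theta>s = b"
      using orth unfolding Q.integral_residual_mult_nth by (simp add: S_def b_def vec_eq_iff)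
    moreover have "\<theta>s \<bullet> (S *v u) = u \<bullet> (S *v \<theta>s)"
      unfolding S_def Q.inner_gram_matrix by (simp add: mult.commute)
    ultimately show ?thesis
      by (simp add: inner_commute)
  qed

  define A where "A n \<omega> = (\<chi> j. emp_mean n Z \<omega> (\<lambda>z. g z $ j))" for n \<omega>
  define B where "B n \<omega> = (\<chi> j k. emp_mean n Z \<omega> (\<lambda>z. g z $ j * g z $ k) - S $ j $ k)" for n \<omega>
  define C where "C n \<omega> = (\<chi> j. emp_mean n Z \<omega> (\<lambda>z. h z * g z $ j) - b $ j)" for n \<omega>
  define \<Delta> where "\<Delta> n \<omega> = (norm (A n \<omega>))\<^sup>2 + (norm (B n \<omega>))\<^sup>2 + (norm (C n \<omega>))\<^sup>2" for n \<omega>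
  \<comment> \<open>The sum of the variances of the coordinates of g, of the products of two of them
    and of h times each, so that the expectation of \<open>\<Delta> n\<close> is
    \<open>\<kappa> / n\<close>.\<close>
  define \<kappa> where "\<kappa> = (\<Sum>j\<in>UNIV. \<integral>z. (g z $ j)\<^sup>2 \<partial>Q)
    + (\<Sum>j\<in>UNIV. \<Sum>k\<in>UNIV. \<integral>z. (g z $ j * g z $ k - S $ j $ k)\<^sup>2 \<partial>Q)
    + (\<Sum>j\<in>UNIV. \<integral>z. (h z * g z $ j - b $ j)\<^sup>2 \<partial>Q)"
  have [measurable]: "\<Delta> n \<in> borel_measurable M" for n
    unfolding \<Delta>_def A_def B_def C_def power2_norm_vec power2_norm_matrix by simp
  have \<Delta>_nonneg: "0 \<le> \<Delta> n \<omega>" for n \<omega>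
    by (simp add: \<Delta>_def)
  have \<Delta>: "integrable M (\<Delta> n) \<and> expectation (\<Delta> n) = \<kappa> / n" if "0 < n" for n
  proof -
    have \<Delta>_eq: "\<Delta> n = (\<lambda>\<omega>. (\<Sum>j\<in>UNIV. (emp_mean n Z \<omega> (\<lambda>z. g z $ j))\<^sup>2)
        + (\<Sum>j\<in>UNIV. \<Sum>k\<in>UNIV. (emp_mean n Z \<omega> (\<lambda>z. g z $ j * g z $ k - S $ j $ k))\<^sup>2)
        + (\<Sum>j\<in>UNIV. (emp_mean n Z \<omega> (\<lambda>z. h z * g z $ j - b $ j))\<^sup>2))"
      using that unfolding \<Delta>_def A_def B_def C_def power2_norm_vec power2_norm_matrix
      by (simp add: emp_mean_diff emp_mean_const)
    have 1: "integrable Q (\<lambda>z. (g z $ j)\<^sup>2)" for j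
      using Q.integrable_bounded_sq[OF _ Q.AE_abs_nth_le, of j 0] by simp
    have 2: "integrable Q (\<lambda>z. (g z $ j * g z $ k - S $ j $ k)\<^sup>2)" for j k
      using Q.AE_abs_mult_le[OF Q.AE_abs_nth_le Q.AE_abs_nth_le] by (intro Q.integrable_bounded_sq) auto
    have 3: "integrable Q (\<lambda>z. (h z * g z $ j - b $ j)\<^sup>2)" for j
      using Q.AE_abs_mult_le[OF h_bdd Q.AE_abs_nth_le] by (intro Q.integrable_bounded_sq) auto
    have 4: "(\<integral>z. g z $ j * g z $ k - S $ j $ k \<partial>Q) = 0" for j k
      using Q.integrable_nth_mult by (simp add: S_def Q.gram_matrix_def Q.prob_space)
    have 5: "(\<integral>z. h z * g z $ j - b $ j \<partial>Q) = 0" for j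
      using Q.integrable_h_mult_nth by (simp add: b_def Q.prob_space)
    note I = integrable_emp_mean_sq[OF _ 1 g_mean] integrable_emp_mean_sq[OF _ 2 4]
      integrable_emp_mean_sq[OF _ 3 5]
    note E = expectation_emp_mean_sq[OF _ 1 g_mean] expectation_emp_mean_sq[OF _ 2 4]
      expectation_emp_mean_sq[OF _ 3 5]
    have "integrable M (\<Delta> n)"
      unfolding \<Delta>_eq by (intro Bochner_Integration.integrable_add Bochner_Integration.integrable_sum I) simp_all
    moreover have "expectation (\<Delta> n) = \<kappa> / n"
      unfolding \<Delta>_eq \<kappa>_def
      by (simp add: I E Bochner_Integration.integral_sum Bochner_Integration.integrable_sum Bochner_Integration.integrable_add
          add_divide_distrib sum_divide_distrib)
    ultimately show ?thesis ..
  qed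

  \<comment> \<open>The constant of the expansion, with \<open>\<bar>K\<bar>\<close> for K so that
    it is visibly positive.\<close>
  define c where "c = 2 / s + 2 * norm \<theta>s / s + (\<bar>K\<bar> + L * norm \<theta>s) * 8 * L\<^sup>2 / s\<^sup>2"
  have "0 < c"
    unfolding c_def using \<open>0 < s\<close> \<open>0 < L\<close> by (intro add_pos_nonneg) auto
  \<comment> \<open>If \<open>\<Delta> n \<omega> \<le> \<mu>\<^sup>2\<close>, then A and B have
    norm at most \<mu>, which gives both smallness hypotheses of the expansion.\<close>
  define \<mu> where "\<mu> = min (s / 4) (s / (4 * L))"
  have "0 < \<mu>" and \<mu>: "\<mu> \<le> s / 4" "\<mu> \<le> s / (4 * L)"
    using \<open>0 < s\<close> \<open>0 < L\<close> by (auto simp: \<mu>_def)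
  define \<delta> where "\<delta> = \<mu>\<^sup>2"
  have "0 < \<delta>"
    using \<open>0 < \<mu>\<close> by (simp add: \<delta>_def)
  \<comment> \<open>f is the influence function of the estimator: X is its normalized sum, to which
    the central limit theorem applies, and Y is the rescaled estimation error.\<close>
  define f where "f z = h z - g z \<bullet> \<theta>s - \<beta>" for z
  define X where "X n \<omega> = (\<Sum>i<n. f (Z i \<omega>)) / sqrt n" for n :: nat and \<omega>
  define Y where "Y n \<omega> = sqrt n * (est n \<omega> - \<beta>)" for n :: nat and \<omega>
  have f_meas [measurable]: "f \<in> borel_measurable N"
    unfolding f_def by measurable
  have X_meas [measurable]: "X n \<in> borel_measurable M" for n
    unfolding X_def by measurable
  have Y_meas [measurable]: "Y n \<in> borel_measurable M" for n
    unfolding Y_def est_def emp_mean_def by measurable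

  have close: "\<bar>Y n \<omega> - X n \<omega>\<bar> \<le> c * sqrt n * \<Delta> n \<omega>"
    if "0 < n" and \<omega>: "\<omega> \<in> space M" "\<omega> \<in> Ev n" and small: "\<Delta> n \<omega> \<le> \<delta>" and hK: "\<And>i. \<bar>h (Z i \<omega>)\<bar> \<le> K" for n \<omega>
  proof -
    have ZN: "Z i \<omega> \<in> space N" for i
      using \<omega>(1) by (rule measurable_space[OF Z_measurable])
    have stat: "emp_mean n Z \<omega> (\<lambda>z. (g z \<bullet> v) / (1 + g z \<bullet> \<theta> n \<omega>)) = 0" for v
      unfolding emp_mean_def
      using log_sum_max_stationary[of n "\<lambda>i. g (Z i \<omega>)" "\<theta> n \<omega>" v] Ev_pos[OF \<omega>(2)] Ev_max[OF \<omega>(2)] by simp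
    \<comment> \<open>Stationarity in the direction of the maximizer shows that the normalizing constant is 1.\<close>
    have "emp_mean n Z \<omega> (\<lambda>z. 1 / (1 + g z \<bullet> \<theta> n \<omega>))
        = emp_mean n Z \<omega> (\<lambda>z. 1 - (g z \<bullet> \<theta> n \<omega>) / (1 + g z \<bullet> \<theta> n \<omega>))"
    proof (rule emp_mean_cong)
      fix i assume "i < n"
      then have "0 < 1 + g (Z i \<omega>) \<bullet> \<theta> n \<omega>"
        by (rule Ev_pos[OF \<omega>(2)])
      then show "1 / (1 + g (Z i \<omega>) \<bullet> \<theta> n \<omega>) = 1 - (g (Z i \<omega>) \<bullet> \<theta> n \<omega>) / (1 + g (Z i \<omega>) \<bullet> \<theta> n \<omega>)"
        by (simp add: field_simps)
    qed
    also have "\<dots> = 1"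
      using stat[of "\<theta> n \<omega>"] \<open>0 < n\<close> by (simp add: emp_mean_diff emp_mean_const)
    finally have est: "est n \<omega> = emp_mean n Z \<omega> (\<lambda>z. h z / (1 + g z \<bullet> \<theta> n \<omega>))"
      by (simp add: est_def)
    have norms: "norm (A n \<omega>) \<le> \<mu>" "norm (B n \<omega>) \<le> \<mu>"
    proof -
      have "(norm (A n \<omega>))\<^sup>2 \<le> \<mu>\<^sup>2" "(norm (B n \<omega>))\<^sup>2 \<le> \<mu>\<^sup>2"
        using small zero_le_power2[of "norm (A n \<omega>)"] zero_le_power2[of "norm (B n \<omega>)"] zero_le_power2[of "norm (C n \<omega>)"]
        unfolding \<Delta>_def \<delta>_def by linarith+
      then show "norm (A n \<omega>) \<le> \<mu>" "norm (B n \<omega>) \<le> \<mu>"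
        using \<open>0 < \<mu>\<close> by (auto intro: power2_le_imp_le)
    qed
    have "\<bar>emp_mean n Z \<omega> (\<lambda>z. h z / (1 + g z \<bullet> \<theta> n \<omega>)) - emp_mean n Z \<omega> (\<lambda>z. h z - g z \<bullet> \<theta>s)\<bar> \<le> c * \<Delta> n \<omega>"
      unfolding c_def \<Delta>_def A_def B_def C_def
    proof (rule empirical_likelihood_expansion)
      show "norm (\<chi> j k. emp_mean n Z \<omega> (\<lambda>z. g z $ j * g z $ k) - S $ j $ k) \<le> s / 4"
        using norms(2) \<mu>(1) by (simp add: B_def)
      show "L * norm (\<chi> j. emp_mean n Z \<omega> (\<lambda>z. g z $ j)) \<le> s / 4"
        using order_trans[OF norms(1) \<mu>(2)] \<open>0 < L\<close> by (simp add: A_def field_simps)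
      show "\<bar>h (Z i \<omega>)\<bar> \<le> \<bar>K\<bar>" for i
        using hK[of i] by linarith
    qed (use g_le[OF ZN] \<open>0 < n\<close> \<open>0 < L\<close> Ev_pos[OF \<omega>(2)] stat \<open>0 < s\<close> coercive normal_eq in auto)
    moreover have "Y n \<omega> - X n \<omega> = sqrt n * (est n \<omega> - emp_mean n Z \<omega> (\<lambda>z. h z - g z \<bullet> \<theta>s))"
    proof -
      have "emp_mean n Z \<omega> f = emp_mean n Z \<omega> (\<lambda>z. h z - g z \<bullet> \<theta>s) - \<beta>"
        unfolding f_def using \<open>0 < n\<close> by (subst emp_mean_diff) (simp add: emp_mean_const)
      moreover have "X n \<omega> = sqrt n * emp_mean n Z \<omega> f"
        using \<open>0 < n\<close> by (simp add: X_def emp_mean_def field_simps flip: real_sqrt_mult)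
      ultimately have "X n \<omega> = sqrt n * (emp_mean n Z \<omega> (\<lambda>z. h z - g z \<bullet> \<theta>s) - \<beta>)"
        by simp
      then show ?thesis
        by (simp add: Y_def algebra_simps)
    qed
    ultimately have "\<bar>Y n \<omega> - X n \<omega>\<bar> \<le> sqrt n * (c * \<Delta> n \<omega>)"
      by (simp add: est abs_mult mult_left_mono)
    then show ?thesis
      by (simp add: mult_ac)
  qed

  have "(\<integral>z. g z \<bullet> u \<partial>Q) = 0" for u
    unfolding inner_vec_def using Q.integrable_nth g_mean by (simp add: Bochner_Integration.integral_sum)
  then have residual_mean: "(\<integral>z. h z - g z \<bullet> \<theta>s \<partial>Q) = \<beta>"
    using Q.integrable_h Q.integrable_inner by (simp add: \<beta>_def)
  have f_mean: "(\<integral>z. f z \<partial>Q) = 0"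
    unfolding f_def using Q.integrable_residual residual_mean by (simp add: Q.prob_space)
  have f_sq: "integrable Q (\<lambda>z. (f z)\<^sup>2)"
    unfolding f_def using Q.AE_abs_residual_le by (intro Q.integrable_bounded_sq) auto
  have f_var: "(\<integral>z. (f z)\<^sup>2 \<partial>Q) = (\<integral>z. (h z - g z \<bullet> \<theta>s)\<^sup>2 \<partial>Q) - \<beta>\<^sup>2"
    using Q.variance_eq[OF Q.integrable_residual Q.integrable_residual_sq, of \<theta>s] by (simp add: residual_mean f_def)

  have "weak_conv_m (\<lambda>n. distr M borel (Y n)) (normal_law (\<integral>z. (f z)\<^sup>2 \<partial>Q))"
  proof (rule weak_conv_m_perturb[OF X_meas Y_meas])
    show "real_distribution (normal_law (\<integral>z. (f z)\<^sup>2 \<partial>Q))"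
      by (rule real_distribution_normal_law) simp
    show "weak_conv_m (\<lambda>n. distr M borel (X n)) (normal_law (\<integral>z. (f z)\<^sup>2 \<partial>Q))"
      unfolding X_def by (rule weak_conv_sum_sample[OF f_meas f_sq f_mean])
    fix e :: real assume "0 < e"
    let ?bad = "\<lambda>n. {\<omega>\<in>space M. e < \<bar>Y n \<omega> - X n \<omega>\<bar>}"
    have markov: "prob {\<omega>\<in>space M. a \<le> \<Delta> n \<omega>} \<le> \<kappa> / n / a" if "0 < a" "0 < n" for a n
      using integral_Markov_inequality_measure[of M "\<Delta> n" "{}" a] \<Delta>[OF \<open>0 < n\<close>] \<open>0 < a\<close>
      by (simp add: \<Delta>_nonneg)
    \<comment> \<open>Almost surely a bad outcome has one of three causes: \<open>Ev n\<close>
      fails, the deviations are too large for the expansion, or the expansion error itself reaches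
      e. Markov's inequality bounds the last two.\<close>
    have bound: "prob (?bad n) \<le> (1 - prob (Ev n)) + \<kappa> / n / \<delta> + \<kappa> / n / (e / (c * sqrt n))" if "0 < n" for n
    proof -
      have "prob (?bad n) \<le> prob ((space M - Ev n) \<union> {\<omega>\<in>space M. \<delta> \<le> \<Delta> n \<omega>} \<union> {\<omega>\<in>space M. e / (c * sqrt n) \<le> \<Delta> n \<omega>})"
      proof (rule finite_measure_mono_AE)
        show "AE \<omega> in M. \<omega> \<in> ?bad n \<longrightarrow> \<omega> \<in> (space M - Ev n) \<union> {\<omega>\<in>space M. \<delta> \<le> \<Delta> n \<omega>} \<union> {\<omega>\<in>space M. e / (c * sqrt n) \<le> \<Delta> n \<omega>}"
          using AE_sample[OF h_bdd]
        proof eventually_elim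
          case (elim \<omega>)
          show ?case
          proof
            assume bad: "\<omega> \<in> ?bad n"
            show "\<omega> \<in> (space M - Ev n) \<union> {\<omega>\<in>space M. \<delta> \<le> \<Delta> n \<omega>} \<union> {\<omega>\<in>space M. e / (c * sqrt n) \<le> \<Delta> n \<omega>}"
            proof (cases "\<omega> \<in> Ev n \<and> \<Delta> n \<omega> \<le> \<delta>")
              case True
              then have "\<bar>Y n \<omega> - X n \<omega>\<bar> \<le> c * sqrt n * \<Delta> n \<omega>"
                using bad elim \<open>0 < n\<close> by (intro close) auto
              then have "e \<le> c * sqrt n * \<Delta> n \<omega>"
                using bad by auto
              then have "e / (c * sqrt n) \<le> \<Delta> n \<omega>"
                using \<open>0 < c\<close> \<open>0 < n\<close> by (simp add: pos_divide_le_eq mult.commute)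
              then show ?thesis
                using bad by auto
            qed (use bad in auto)
          qed
        qed
      qed measurable
      also have "\<dots> \<le> prob (space M - Ev n) + prob {\<omega>\<in>space M. \<delta> \<le> \<Delta> n \<omega>} + prob {\<omega>\<in>space M. e / (c * sqrt n) \<le> \<Delta> n \<omega>}"
        by (intro order_trans[OF measure_Un_le] add_mono order_refl) measurable
      also have "\<dots> \<le> (1 - prob (Ev n)) + \<kappa> / n / \<delta> + \<kappa> / n / (e / (c * sqrt n))"
        using \<open>0 < \<delta>\<close> \<open>0 < e\<close> \<open>0 < c\<close> \<open>0 < n\<close> by (intro add_mono markov) (auto simp: prob_compl)
      finally show ?thesis .
    qed
    \<comment> \<open>In the last term the decay 1/n of the expected deviation beats the factor
      \<open>sqrt n\<close>, leaving order \<open>1 / sqrt n\<close>.\<close>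
    have lim: "(\<lambda>n. (1 - prob (Ev n)) + \<kappa> / n / \<delta> + \<kappa> / n / (e / (c * sqrt n))) \<longlonglongrightarrow> 0"
    proof -
      have "(\<lambda>n. 1 / sqrt (real n)) \<longlonglongrightarrow> 0"
        by (intro tendsto_divide_0[OF tendsto_const] filterlim_at_top_imp_at_infinity
            filterlim_compose[OF sqrt_at_top filterlim_real_sequentially])
      then have "(\<lambda>n. (1 - prob (Ev n)) + \<kappa> * (1 / real n) / \<delta> + (\<kappa> * c / e) * (1 / sqrt n)) \<longlonglongrightarrow> (1 - 1) + \<kappa> * 0 / \<delta> + (\<kappa> * c / e) * 0"
        using Ev_prob lim_1_over_n \<open>0 < \<delta>\<close> by (intro tendsto_intros) auto
      moreover have "\<kappa> / n / (e / (c * sqrt n)) = (\<kappa> * c / e) * (1 / sqrt n)" for n :: nat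
      proof -
        have "\<kappa> / n / (e / (c * sqrt n)) = (\<kappa> * c / e) * (sqrt n / n)"
          by (simp add: mult_ac)
        also have "sqrt n / n = 1 / sqrt n"
          by (simp add: sqrt_divide_self_eq inverse_eq_divide)
        finally show ?thesis .
      qed
      ultimately show ?thesis
        by simp
    qed
    show "(\<lambda>n. prob (?bad n)) \<longlonglongrightarrow> 0"
    proof (rule tendsto_sandwich[OF _ _ tendsto_const lim])
      show "eventually (\<lambda>n. prob (?bad n) \<le> (1 - prob (Ev n)) + \<kappa> / n / \<delta> + \<kappa> / n / (e / (c * sqrt n))) sequentially"
        using eventually_gt_at_top[of 0] by eventually_elim (rule bound)
    qed simp
  qed
  then show ?thesis
    unfolding f_var Y_def .
qed

end

subsection \<open>The contextual bandit model\<close>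

text \<open>Packs the parameters in the index type of \<open>gvec\<close>: \<open>None\<close> is
  the slot of the constant function, \<open>Some j\<close> that of the j-th basis function.\<close>

definition coef :: "real \<Rightarrow> real^'d \<Rightarrow> real^('d option)" where
  "coef \<xi> \<tau> = (\<chi> i. case i of None \<Rightarrow> \<xi> | Some j \<Rightarrow> \<tau> $ j)"

text \<open>Shows that ranging over pairs of parameters is the same as ranging over all
  vectors.\<close>

lemma coef_surj: "coef (\<theta> $ None) (\<chi> j. \<theta> $ Some j) = \<theta>"
  by (simp add: coef_def vec_eq_iff split: option.split)

lemma gvec_nth:
  "gvec pie pib t x a $ i = Fop pie pib (\<lambda>x a. case i of None \<Rightarrow> 1 | Some j \<Rightarrow> t x a $ j) x a"
  by (simp add: gvec_def split: option.split)

text \<open>\<open>Fop\<close> is linear in its model argument; the work is splitting off the index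
  \<open>None\<close> and exchanging the sums over actions and coordinates.\<close>

lemma gvec_inner_coef: "gvec pie pib t x a \<bullet> coef \<xi> \<tau> = Fop pie pib (lin_model t \<xi> \<tau>) x a"
proof -
  have "gvec pie pib t x a \<bullet> coef \<xi> \<tau>
      = Fop pie pib (\<lambda>_ _. 1) x a * \<xi> + (\<Sum>j\<in>UNIV. Fop pie pib (\<lambda>x a. t x a $ j) x a * \<tau> $ j)"
    by (simp add: inner_vec_def gvec_def coef_def UNIV_option_conv sum.reindex)
  also have "\<dots> = Fop pie pib (lin_model t \<xi> \<tau>) x a"
  proof -
    have "(\<Sum>a'\<in>UNIV. (\<Sum>j\<in>UNIV. t x a' $ j * \<tau> $ j) * pmf (pie x) a')
        = (\<Sum>j\<in>UNIV. (\<Sum>a'\<in>UNIV. t x a' $ j * pmf (pie x) a') * \<tau> $ j)"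
      unfolding sum_distrib_right by (subst sum.swap) (simp add: mult_ac)
    then show ?thesis
      by (simp add: Fop_def lin_model_def inner_vec_def algebra_simps sum.distrib sum_subtractf sum_distrib_left)
  qed
  finally show ?thesis .
qed

locale contextual_bandit =
  fixes P0 :: "'x measure"
    and pib pie :: "'x \<Rightarrow> 'a::finite pmf"
    and Pr :: "'x \<Rightarrow> 'a \<Rightarrow> real measure"
    and Rmax :: real
  assumes P0: "prob_space P0"
    and pib_meas: "\<And>a. (\<lambda>x. pmf (pib x) a) \<in> borel_measurable P0"
    and pie_meas: "\<And>a. (\<lambda>x. pmf (pie x) a) \<in> borel_measurable P0"
    and Pr_kernel: "\<And>a. (\<lambda>x. Pr x a) \<in> measurable P0 (subprob_algebra borel)"
    and Pr_prob: "\<And>x a. x \<in> space P0 \<Longrightarrow> prob_space (Pr x a)"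
    and Pr_range: "\<And>x a. x \<in> space P0 \<Longrightarrow> measure (Pr x a) {0..Rmax} = 1"
    and overlap: "\<And>x a. x \<in> space P0 \<Longrightarrow> pmf (pie x) a > 0 \<Longrightarrow> pmf (pib x) a > 0"
begin

abbreviation "D \<equiv> data_dist P0 pib Pr"
abbreviation "w \<equiv> wt pie pib"
abbreviation "F \<equiv> Fop pie pib"

text \<open>Actions form a countable discrete space, so measurability in the context for each fixed
  action gives joint measurability.\<close>

lemma measurable_obs_action:
  fixes f :: "'a \<Rightarrow> 'x \<Rightarrow> real"
  assumes "\<And>a. f a \<in> borel_measurable P0"
  shows "(\<lambda>z. f (fst (snd z)) (fst z)) \<in> borel_measurable (obs_space P0)"
  unfolding obs_space_def
proof (rule measurable_compose_countable[where f = "\<lambda>a z. f a (fst z)"])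
  show "(\<lambda>z. f a (fst z)) \<in> borel_measurable (P0 \<Otimes>\<^sub>M (count_space UNIV \<Otimes>\<^sub>M borel))" for a
    using assms by measurable
qed measurable

lemma measurable_obs_reward [measurable]: "(\<lambda>z. snd (snd z)) \<in> borel_measurable (obs_space P0)"
  unfolding obs_space_def by measurable

text \<open>Overlap takes care of division by zero: an action of behavior probability 0 also has
  evaluation probability 0, and both sides vanish.\<close>

lemma pib_wt: "x \<in> space P0 \<Longrightarrow> pmf (pib x) a * w x a = pmf (pie x) a"
  using overlap[of x a] pmf_nonneg[of "pie x" a] by (auto simp: wt_def less_le)

lemma measurable_wt [measurable]: "(\<lambda>x. w x a) \<in> borel_measurable P0"
  unfolding wt_def using pie_meas pib_meas by measurable

lemma measurable_Fop [measurable]: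
  assumes [measurable]: "\<And>a. (\<lambda>x. m x a) \<in> borel_measurable P0"
  shows "(\<lambda>x. F m x a) \<in> borel_measurable P0"
  unfolding Fop_def using pie_meas by measurable

section \<open>Disintegration of the data distribution\<close>

lemma measurable_behavior_kernel:
  "(\<lambda>x. measure_pmf (pib x)) \<in> measurable P0 (subprob_algebra (count_space UNIV))"
proof (rule measurable_subprob_algebra)
  show "subprob_space (measure_pmf (pib x))" for x
    by (rule prob_space_imp_subprob_space) (rule measure_pmf.prob_space_axioms)
  fix A :: "'a set"
  have "emeasure (measure_pmf (pib x)) A = ennreal (\<Sum>a\<in>A. pmf (pib x) a)" for x
    by (simp add: measure_pmf.emeasure_eq_measure measure_measure_pmf_finite)
  then show "(\<lambda>x. emeasure (measure_pmf (pib x)) A) \<in> borel_measurable P0"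
    using pib_meas by simp
qed simp

lemma measurable_reward_kernel:
  "(\<lambda>z. Pr (fst z) (snd z)) \<in> measurable (P0 \<Otimes>\<^sub>M count_space UNIV) (subprob_algebra borel)"
proof (rule measurable_compose_countable[where f = "\<lambda>a z. Pr (fst z) a"])
  show "(\<lambda>z. Pr (fst z) a) \<in> measurable (P0 \<Otimes>\<^sub>M count_space UNIV) (subprob_algebra borel)" for a
    using Pr_kernel by measurable
qed measurable

lemma measurable_return_obs:
  "(\<lambda>z. return (obs_space P0) (fst (fst z), snd (fst z), snd z))
    \<in> measurable ((P0 \<Otimes>\<^sub>M count_space UNIV) \<Otimes>\<^sub>M borel) (subprob_algebra (obs_space P0))"
  by (rule measurable_compose[OF _ return_measurable]) (unfold obs_space_def, measurable)

lemma measurable_action_reward_kernel: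
  "(\<lambda>z. Pr (fst z) (snd z) \<bind> (\<lambda>r. return (obs_space P0) (fst z, snd z, r)))
    \<in> measurable (P0 \<Otimes>\<^sub>M count_space UNIV) (subprob_algebra (obs_space P0))"
  by (rule measurable_bind[OF measurable_reward_kernel measurable_return_obs])

lemma measurable_data_kernel:
  "(\<lambda>x. measure_pmf (pib x) \<bind> (\<lambda>a. Pr x a \<bind> (\<lambda>r. return (obs_space P0) (x, a, r))))
    \<in> measurable P0 (subprob_algebra (obs_space P0))"
  by (rule measurable_bind[OF measurable_behavior_kernel measurable_action_reward_kernel])

lemma
  assumes x: "x \<in> space P0"
  shows measurable_return_obs1: "(\<lambda>r. return (obs_space P0) (x, a, r)) \<in> measurable (Pr x a) (subprob_algebra (obs_space P0))"
    and measurable_reward_bind: "(\<lambda>a. Pr x a \<bind> (\<lambda>r. return (obs_space P0) (x, a, r)))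
      \<in> measurable (measure_pmf (pib x)) (subprob_algebra (obs_space P0))"
proof -
  have "sets (Pr x a) = sets borel"
    using x by (rule sets_kernel[OF Pr_kernel])
  moreover have "(x, a) \<in> space (P0 \<Otimes>\<^sub>M count_space UNIV)"
    using x by (simp add: space_pair_measure)
  ultimately show "(\<lambda>r. return (obs_space P0) (x, a, r)) \<in> measurable (Pr x a) (subprob_algebra (obs_space P0))"
    using measurable_Pair2[OF measurable_return_obs, of "(x, a)"] by (simp cong: measurable_cong_sets)
  show "(\<lambda>a. Pr x a \<bind> (\<lambda>r. return (obs_space P0) (x, a, r)))
      \<in> measurable (measure_pmf (pib x)) (subprob_algebra (obs_space P0))"
    using measurable_Pair2[OF measurable_action_reward_kernel x] by (simp cong: measurable_cong_sets)
qed

text \<open>A property that holds for almost every reward, given any context and action, passes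
  through the binds over rewards, actions and contexts in turn.\<close>

lemma AE_data_dist:
  assumes P: "Measurable.pred (obs_space P0) P"
    and *: "\<And>x a. x \<in> space P0 \<Longrightarrow> AE r in Pr x a. P (x, a, r)"
  shows "AE z in D. P z"
  unfolding data_dist_def AE_bind[OF measurable_data_kernel P]
proof (rule AE_I2)
  fix x assume x: "x \<in> space P0"
  have "AE z in Pr x a \<bind> (\<lambda>r. return (obs_space P0) (x, a, r)). P z" for a
    unfolding AE_bind[OF measurable_return_obs1[OF x] P]
    using *[OF x, of a]
  proof eventually_elim
    case (elim r)
    then show ?case
      using x P by (subst AE_return) (auto simp: obs_space_def space_pair_measure)
  qed
  then show "AE z in measure_pmf (pib x) \<bind> (\<lambda>a. Pr x a \<bind> (\<lambda>r. return (obs_space P0) (x, a, r))). P z"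
    unfolding AE_bind[OF measurable_reward_bind[OF x] P] by simp
qed

lemma AE_reward_range: "AE z in D. snd (snd z) \<in> {0..Rmax}"
proof (rule AE_data_dist)
  fix x a assume x: "x \<in> space P0"
  interpret prob_space "Pr x a" using x by (rule Pr_prob)
  have "sets (Pr x a) = sets borel"
    using x by (rule sets_kernel[OF Pr_kernel])
  then show "AE r in Pr x a. snd (snd (x, a, r)) \<in> {0..Rmax}"
    using AE_prob_1[OF Pr_range[OF x, of a]] by simp
qed measurable

text \<open>Each of the three sampling stages is unfolded by \<open>integral_bind\<close>, for which
  f is bounded on the whole observation space; the action stage is a finite sum.\<close>

lemma integral_data_dist:
  fixes f :: "'x \<times> 'a \<times> real \<Rightarrow> real"
  assumes f: "f \<in> borel_measurable (obs_space P0)"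
    and bound: "\<And>z. z \<in> space (obs_space P0) \<Longrightarrow> \<bar>f z\<bar> \<le> B"
  shows "(\<integral>z. f z \<partial>D) = (\<integral>x. (\<Sum>a\<in>UNIV. pmf (pib x) a * (\<integral>r. f (x, a, r) \<partial>Pr x a)) \<partial>P0)"
proof -
  interpret P0: prob_space P0 by (rule P0)
  have le1: "emeasure K (space K) \<le> 1" if "K \<in> space (subprob_algebra (obs_space P0))" for K
    using that by (simp add: space_subprob_algebra subprob_space.emeasure_space_le_1)
  have "(\<integral>z. f z \<partial>D) = (\<integral>x. (\<integral>z. f z \<partial>(measure_pmf (pib x) \<bind> (\<lambda>a. Pr x a \<bind> (\<lambda>r. return (obs_space P0) (x, a, r))))) \<partial>P0)"
    unfolding data_dist_def
    using f bound measurable_data_kernel P0.finite_measure_axioms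
    by (rule integral_bind[where B' = 1])
       (auto intro!: AE_I2 le1 measurable_space[OF measurable_data_kernel])
  also have "\<dots> = (\<integral>x. (\<Sum>a\<in>UNIV. pmf (pib x) a * (\<integral>r. f (x, a, r) \<partial>Pr x a)) \<partial>P0)"
  proof (rule Bochner_Integration.integral_cong[OF refl])
    fix x assume x: "x \<in> space P0"
    have inner: "(\<integral>z. f z \<partial>(Pr x a \<bind> (\<lambda>r. return (obs_space P0) (x, a, r)))) = (\<integral>r. f (x, a, r) \<partial>Pr x a)" for a
    proof -
      interpret Pr: prob_space "Pr x a" using x by (rule Pr_prob)
      have "(\<integral>z. f z \<partial>(Pr x a \<bind> (\<lambda>r. return (obs_space P0) (x, a, r))))
          = (\<integral>r. (\<integral>z. f z \<partial>return (obs_space P0) (x, a, r)) \<partial>Pr x a)"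
        using f bound measurable_return_obs1[OF x] Pr.finite_measure_axioms
        by (rule integral_bind[where B' = 1])
           (auto intro!: AE_I2 split: split_indicator)
      also have "\<dots> = (\<integral>r. f (x, a, r) \<partial>Pr x a)"
        using x f by (simp add: integral_return obs_space_def space_pair_measure)
      finally show ?thesis .
    qed
    have "(\<integral>z. f z \<partial>(measure_pmf (pib x) \<bind> (\<lambda>a. Pr x a \<bind> (\<lambda>r. return (obs_space P0) (x, a, r)))))
        = (\<integral>a. (\<integral>z. f z \<partial>(Pr x a \<bind> (\<lambda>r. return (obs_space P0) (x, a, r)))) \<partial>measure_pmf (pib x))"
      using f bound measurable_reward_bind[OF x] measure_pmf.finite_measure_axioms
      by (rule integral_bind[where B' = 1])
         (auto intro!: AE_I2 le1 measurable_space[OF measurable_reward_bind[OF x]])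
    also have "\<dots> = (\<Sum>a\<in>UNIV. pmf (pib x) a * (\<integral>r. f (x, a, r) \<partial>Pr x a))"
      unfolding inner by (subst integral_measure_pmf_real[where A = UNIV]) (auto simp: mult.commute)
    finally show "(\<integral>z. f z \<partial>(measure_pmf (pib x) \<bind> (\<lambda>a. Pr x a \<bind> (\<lambda>r. return (obs_space P0) (x, a, r)))))
        = (\<Sum>a\<in>UNIV. pmf (pib x) a * (\<integral>r. f (x, a, r) \<partial>Pr x a))" .
  qed
  finally show ?thesis .
qed

section \<open>Mean-zero identities for control variates and reward residuals\<close>

lemma sum_pib_Fop:
  assumes x: "x \<in> space P0"
  shows "(\<Sum>a\<in>UNIV. pmf (pib x) a * F m x a) = 0"
proof -
  have "(\<Sum>a\<in>UNIV. pmf (pib x) a) = 1"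
    by (rule sum_pmf_eq_1) auto
  then have "(\<Sum>a\<in>UNIV. pmf (pib x) a * (\<Sum>a'\<in>UNIV. m x a' * pmf (pie x) a')) = (\<Sum>a'\<in>UNIV. m x a' * pmf (pie x) a')"
    unfolding sum_distrib_right[symmetric] by simp
  moreover have "(\<Sum>a\<in>UNIV. pmf (pib x) a * (w x a * m x a)) = (\<Sum>a\<in>UNIV. m x a * pmf (pie x) a)"
    by (intro sum.cong refl) (simp flip: pib_wt[OF x])
  ultimately show ?thesis
    by (simp add: Fop_def right_diff_distrib sum_subtractf)
qed

lemma abs_Fop_le:
  assumes "\<bar>w x a\<bar> \<le> W" "\<And>a. \<bar>m x a\<bar> \<le> c"
  shows "\<bar>F m x a\<bar> \<le> W * c + c"
proof -
  have "\<bar>\<Sum>a'\<in>UNIV. m x a' * pmf (pie x) a'\<bar> \<le> (\<Sum>a'\<in>UNIV. \<bar>m x a' * pmf (pie x) a'\<bar>)"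
    by (rule sum_abs)
  also have "\<dots> \<le> (\<Sum>a'\<in>UNIV. c * pmf (pie x) a')"
    using assms(2) by (intro sum_mono) (simp add: abs_mult mult_right_mono)
  also have "\<dots> = c"
    using sum_pmf_eq_1[of UNIV "pie x"] by (simp flip: sum_distrib_left)
  finally have "\<bar>\<Sum>a'\<in>UNIV. m x a' * pmf (pie x) a'\<bar> \<le> c" .
  moreover have "\<bar>w x a * m x a\<bar> \<le> W * c"
    unfolding abs_mult using assms by (intro mult_mono) auto
  ultimately show ?thesis
    unfolding Fop_def by linarith
qed

text \<open>Given the context, weighting by w turns the behavior average of m into its evaluation
  average, which is what \<open>Fop\<close> subtracts. So \<open>F m\<close> has conditional mean
  zero and is orthogonal to functions of the context.\<close>

lemma integral_context_mult_Fop: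
  assumes [measurable]: "V \<in> borel_measurable P0" and m: "\<And>a. (\<lambda>x. m x a) \<in> borel_measurable P0"
    and bound: "\<And>x a. x \<in> space P0 \<Longrightarrow> \<bar>V x * F m x a\<bar> \<le> c"
  shows "(\<integral>z. V (fst z) * F m (fst z) (fst (snd z)) \<partial>D) = 0"
proof -
  have "(\<integral>z. V (fst z) * F m (fst z) (fst (snd z)) \<partial>D)
      = (\<integral>x. (\<Sum>a\<in>UNIV. pmf (pib x) a * (\<integral>r. V x * F m x a \<partial>Pr x a)) \<partial>P0)"
  proof (subst integral_data_dist)
    show "(\<lambda>z. V (fst z) * F m (fst z) (fst (snd z))) \<in> borel_measurable (obs_space P0)"
      using m by (intro measurable_obs_action[where f = "\<lambda>a x. V x * F m x a"]) measurable
    show "\<bar>V (fst z) * F m (fst z) (fst (snd z))\<bar> \<le> c" if "z \<in> space (obs_space P0)" for z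
      using that by (intro bound) (auto simp: obs_space_def space_pair_measure)
  qed simp
  also have "\<dots> = (\<integral>x. 0 \<partial>P0)"
  proof (rule Bochner_Integration.integral_cong[OF refl])
    fix x assume x: "x \<in> space P0"
    have inner: "(\<integral>r. V x * F m x a \<partial>Pr x a) = V x * F m x a" for a
      using prob_space.prob_space[OF Pr_prob[OF x, of a]] by simp
    show "(\<Sum>a\<in>UNIV. pmf (pib x) a * (\<integral>r. V x * F m x a \<partial>Pr x a)) = 0"
      unfolding inner using sum_pib_Fop[OF x, of m] by (simp add: mult.left_commute[of _ "V x"] flip: sum_distrib_left)
  qed
  finally show ?thesis by simp
qed

text \<open>Given context and action, \<psi> is constant and the reward residual has mean
  zero.\<close>

lemma integral_mult_reward_residual:
  assumes \<psi>: "\<And>a. (\<lambda>x. \<psi> x a) \<in> borel_measurable P0" and q: "\<And>a. (\<lambda>x. q x a) \<in> borel_measurable P0"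
    and \<psi>_bdd: "\<And>x a. x \<in> space P0 \<Longrightarrow> \<bar>\<psi> x a\<bar> \<le> c" and q_bdd: "\<And>x a. x \<in> space P0 \<Longrightarrow> \<bar>q x a\<bar> \<le> c'"
    and mean: "\<And>x a. x \<in> space P0 \<Longrightarrow> (\<integral>r. r \<partial>Pr x a) = q x a"
  shows "(\<integral>z. \<psi> (fst z) (fst (snd z)) * (snd (snd z) - q (fst z) (fst (snd z))) \<partial>D) = 0"
proof -
  have sets_D: "sets D = sets (obs_space P0)"
    unfolding data_dist_def
    by (rule sets_bind[OF sets_kernel[OF measurable_data_kernel]]) (auto simp: prob_space.not_empty[OF P0])
  note [measurable_cong] = sets_D
  \<comment> \<open>Rewards lie in \<open>{0..Rmax}\<close> only almost surely, while the
    disintegration formula asks for a bound everywhere. Clipping changes nothing almost surely; the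
    absolute value gives a bound whatever the sign of \<open>Rmax\<close>.\<close>
  define clip where "clip r = min (max 0 r) \<bar>Rmax\<bar>" for r :: real
  have clip: "clip r = r" if "r \<in> {0..Rmax}" for r
    using that by (auto simp: clip_def)
  have clip_bdd: "\<bar>clip r\<bar> \<le> \<bar>Rmax\<bar>" for r
    by (auto simp: clip_def)
  have [measurable]: "clip \<in> borel_measurable borel"
    unfolding clip_def by measurable
  have [measurable]: "(\<lambda>z. \<psi> (fst z) (fst (snd z))) \<in> borel_measurable (obs_space P0)"
    using \<psi> by (intro measurable_obs_action[where f = "\<lambda>a x. \<psi> x a"])
  have [measurable]: "(\<lambda>z. q (fst z) (fst (snd z))) \<in> borel_measurable (obs_space P0)"
    using q by (intro measurable_obs_action[where f = "\<lambda>a x. q x a"])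
  have "(\<integral>z. \<psi> (fst z) (fst (snd z)) * (snd (snd z) - q (fst z) (fst (snd z))) \<partial>D)
      = (\<integral>z. \<psi> (fst z) (fst (snd z)) * (clip (snd (snd z)) - q (fst z) (fst (snd z))) \<partial>D)"
    by (rule integral_cong_AE) (use AE_reward_range in \<open>auto simp: clip elim: eventually_mono\<close>)
  also have "\<dots> = (\<integral>x. (\<Sum>a\<in>UNIV. pmf (pib x) a * (\<integral>r. \<psi> x a * (clip r - q x a) \<partial>Pr x a)) \<partial>P0)"
  proof (subst integral_data_dist)
    show "\<bar>\<psi> (fst z) (fst (snd z)) * (clip (snd (snd z)) - q (fst z) (fst (snd z)))\<bar> \<le> c * (\<bar>Rmax\<bar> + c')"
      if "z \<in> space (obs_space P0)" for z
    proof -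
      have z: "fst z \<in> space P0"
        using that by (auto simp: obs_space_def space_pair_measure)
      have "\<bar>clip (snd (snd z)) - q (fst z) (fst (snd z))\<bar> \<le> \<bar>Rmax\<bar> + c'"
        using clip_bdd[of "snd (snd z)"] q_bdd[OF z, of "fst (snd z)"] by linarith
      then show ?thesis
        unfolding abs_mult using \<psi>_bdd[OF z] order_trans[OF abs_ge_zero \<psi>_bdd[OF z]] by (intro mult_mono) auto
    qed
  qed simp_all
  also have "\<dots> = (\<integral>x. 0 \<partial>P0)"
  proof (rule Bochner_Integration.integral_cong[OF refl])
    fix x assume x: "x \<in> space P0"
    have inner: "(\<integral>r. \<psi> x a * (clip r - q x a) \<partial>Pr x a) = 0" for a
    proof -
      interpret Pr: prob_space "Pr x a" using x by (rule Pr_prob)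
      have sets_Pr [measurable_cong]: "sets (Pr x a) = sets borel"
        using x by (rule sets_kernel[OF Pr_kernel])
      have "integrable (Pr x a) clip"
        using clip_bdd by (intro Pr.integrable_const_bound[where B = "\<bar>Rmax\<bar>"]) auto
      moreover have "(\<integral>r. clip r \<partial>Pr x a) = (\<integral>r. r \<partial>Pr x a)"
        by (rule integral_cong_AE)
           (use Pr.AE_prob_1[OF Pr_range[OF x, of a]] in \<open>auto simp: clip elim: eventually_mono\<close>)
      ultimately show ?thesis
        by (simp add: mean[OF x] Pr.prob_space)
    qed
    show "(\<Sum>a\<in>UNIV. pmf (pib x) a * (\<integral>r. \<psi> x a * (clip r - q x a) \<partial>Pr x a)) = 0"
      unfolding inner by simp
  qed
  finally show ?thesis by simp
qed

end

theorem theorem2: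
  fixes P0 :: "'x measure"
    and pib pie :: "'x \<Rightarrow> 'a::finite pmf"
    and Pr :: "'x \<Rightarrow> 'a \<Rightarrow> real measure"
    and Rmax :: real
    and t :: "'x \<Rightarrow> 'a \<Rightarrow> real^'d"
    and M :: "'w measure"
    and Z :: "nat \<Rightarrow> 'w \<Rightarrow> 'x \<times> 'a \<times> real"
    and xih :: "nat \<Rightarrow> 'w \<Rightarrow> real"
    and tauh :: "nat \<Rightarrow> 'w \<Rightarrow> real^'d"
    and Ev :: "nat \<Rightarrow> 'w set"
  defines "D \<equiv> data_dist P0 pib Pr"
    and "w \<equiv> wt pie pib"
    and "F \<equiv> Fop pie pib"
    and "\<beta> \<equiv> \<integral>(x,a,r). wt pie pib x a * r \<partial>data_dist P0 pib Pr"
  assumes P0: "prob_space P0"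
    and pib_meas: "\<And>a. (\<lambda>x. pmf (pib x) a) \<in> borel_measurable P0"
    and pie_meas: "\<And>a. (\<lambda>x. pmf (pie x) a) \<in> borel_measurable P0"
    and Pr_kernel: "\<And>a. (\<lambda>x. Pr x a) \<in> measurable P0 (subprob_algebra borel)"
    and Pr_prob: "\<And>x a. x \<in> space P0 \<Longrightarrow> prob_space (Pr x a)"
    and Pr_range: "\<And>x a. x \<in> space P0 \<Longrightarrow> measure (Pr x a) {0..Rmax} = 1"
    and overlap: "\<And>x a. x \<in> space P0 \<Longrightarrow> pmf (pie x) a > 0 \<Longrightarrow> pmf (pib x) a > 0"
    and w_bdd: "\<exists>W. \<forall>x\<in>space P0. \<forall>a. \<bar>w x a\<bar> \<le> W"
    and t_meas: "\<And>a j. (\<lambda>x. t x a $ j) \<in> borel_measurable P0"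
    and t_bdd: "\<exists>B. \<forall>x\<in>space P0. \<forall>a. norm (t x a) \<le> B"
    and t_indep: "\<And>c. (\<forall>x\<in>space P0. \<forall>a. t x a \<bullet> c = 0) \<Longrightarrow> c = 0"
    and t_nonconst: "\<And>j k. \<not> (\<forall>x\<in>space P0. \<forall>a. t x a $ j = k)"
    and gram_nonsing: "invertible (gram D pie pib t)"
    and M: "prob_space M"
    and Z_meas: "\<And>i. Z i \<in> measurable M (obs_space P0)"
    and Z_indep: "prob_space.indep_vars M (\<lambda>_. obs_space P0) Z UNIV"
    and Z_dist: "\<And>i. distr M (obs_space P0) (Z i) = D"
    and xih_meas: "\<And>n. xih n \<in> borel_measurable M"
    and tauh_meas: "\<And>n. tauh n \<in> borel_measurable M"
    and Ev_sets: "\<And>n. Ev n \<in> sets M"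
    and Ev_prob: "(\<lambda>n. measure M (Ev n)) \<longlonglongrightarrow> 1"
    and Ev_max: "\<And>n \<omega>. \<omega> \<in> Ev n \<Longrightarrow> is_emp_max pie pib t n Z \<omega> (xih n \<omega>) (tauh n \<omega>)"
  shows "\<exists>\<sigma>2.
     asymp_normal M (\<lambda>n \<omega>. beta_emp pie pib t n Z \<omega> (xih n \<omega>) (tauh n \<omega>)) \<beta> \<sigma>2
   \<and> is_arg_min id (\<lambda>v. \<exists>\<zeta> \<tau>. v = (\<integral>(x,a,r). (w x a * r - F (lin_model t \<zeta> \<tau>) x a)\<^sup>2 \<partial>D) - \<beta>\<^sup>2) \<sigma>2
   \<and> \<sigma>2 \<le> var_D D (\<lambda>(x,a,r). w x a * r)
   \<and> \<sigma>2 \<le> var_D D (\<lambda>(x,a,r). w x a * (r - \<beta>))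
   \<and> (\<forall>\<tau>d. \<sigma>2 \<le> var_D D (\<lambda>(x,a,r). w x a * r - F (lin_model t 0 \<tau>d) x a))
   \<and> (\<forall>\<tau>0. (\<forall>x\<in>space P0. \<forall>a. (\<integral>r. r \<partial>Pr x a) = t x a \<bullet> \<tau>0) \<longrightarrow>
        \<sigma>2 = var_D D (\<lambda>(x,a,r). w x a * (r - t x a \<bullet> \<tau>0)
                                 + (\<Sum>a'\<in>UNIV. (t x a' \<bullet> \<tau>0) * pmf (pie x) a')))"
proof -
  interpret bandit: contextual_bandit P0 pib pie Pr Rmax
    by (rule contextual_bandit.intro) fact+
  interpret iid_sample M "obs_space P0" D Z
    using M Z_indep Z_dist by (simp add: iid_sample_def iid_sample_axioms_def)
  note sets_Q [measurable_cong]

  \<comment> \<open>The bandit data as a bounded regression\<close>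
  define g where "g z = gvec pie pib t (fst z) (fst (snd z))" for z :: "'x \<times> 'a \<times> real"
  define h where "h z = w (fst z) (fst (snd z)) * snd (snd z)" for z :: "'x \<times> 'a \<times> real"
  obtain W where W: "\<And>x a. x \<in> space P0 \<Longrightarrow> \<bar>w x a\<bar> \<le> W"
    using w_bdd by blast
  obtain B where B: "\<And>x a. x \<in> space P0 \<Longrightarrow> norm (t x a) \<le> B"
    using t_bdd by blast
  have sp: "fst z \<in> space P0" if "z \<in> space (obs_space P0)" for z :: "'x \<times> 'a \<times> real"
    using that by (auto simp: obs_space_def space_pair_measure)
  \<comment> \<open>The basis extended by the constant function, so that every coordinate of g has
    the uniform form \<open>F (m i)\<close>.\<close>
  define m :: "'d option \<Rightarrow> 'x \<Rightarrow> 'a \<Rightarrow> real"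
    where "m i x a = (case i of None \<Rightarrow> 1 | Some j \<Rightarrow> t x a $ j)" for i x a
  have m_meas [measurable]: "(\<lambda>x. m i x a) \<in> borel_measurable P0" for i a
    using t_meas by (cases i) (simp_all add: m_def)
  have m_bdd: "\<bar>m i x a\<bar> \<le> max 1 B" if "x \<in> space P0" for i x a
  proof (cases i)
    case (Some j)
    then show ?thesis
      using component_le_norm_cart[of "t x a" j] B[OF that, of a] by (simp add: m_def)
  qed (simp add: m_def)
  define G where "G = W * max 1 B + max 1 B"
  have Fm_bdd: "\<bar>F (m i) x a\<bar> \<le> G" if "x \<in> space P0" for i x a
    unfolding F_def G_def using W[OF that] m_bdd[OF that] by (intro bandit.abs_Fop_le) (auto simp: w_def)
  have gF: "gvec pie pib t x a $ i = F (m i) x a" for x a i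
    unfolding F_def m_def by (rule gvec_nth)
  have Fm_meas [measurable]: "(\<lambda>x. F (m i) x a) \<in> borel_measurable P0" for i a
    unfolding F_def by measurable
  have g_meas [measurable]: "g \<in> borel_measurable (obs_space P0)"
  proof (subst borel_measurable_euclidean_space, rule ballI)
    fix u :: "real^('d option)" assume "u \<in> Basis"
    then obtain i where "u = axis i 1"
      by (auto simp: Basis_vec_def)
    then show "(\<lambda>z. g z \<bullet> u) \<in> borel_measurable (obs_space P0)"
      unfolding g_def
      by (simp add: inner_axis gF) (intro bandit.measurable_obs_action[where f = "\<lambda>a x. F (m i) x a"] Fm_meas)
  qed
  have h_meas [measurable]: "h \<in> borel_measurable (obs_space P0)"
    unfolding h_def w_def
    by (intro borel_measurable_times bandit.measurable_obs_reward
        bandit.measurable_obs_action[where f = "\<lambda>a x. wt pie pib x a"] bandit.measurable_wt)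
  \<comment> \<open>The Euclidean norm is at most the sum of the absolute coordinates, each bounded
    by G.\<close>
  define L where "L = real CARD('d option) * G"
  have g_bdd: "norm (g z) \<le> L" if "z \<in> space (obs_space P0)" for z
  proof -
    have "norm (g z) \<le> (\<Sum>i\<in>UNIV. \<bar>g z $ i\<bar>)"
      by (rule norm_le_l1_cart)
    also have "\<dots> \<le> (\<Sum>i\<in>(UNIV :: 'd option set). G)"
      using Fm_bdd[OF sp[OF that]] by (intro sum_mono) (simp add: g_def gF)
    finally show ?thesis
      by (simp add: L_def)
  qed
  have h_bdd: "AE z in D. \<bar>h z\<bar> \<le> W * Rmax"
    using bandit.AE_reward_range[folded D_def] AE_space
  proof eventually_elim
    case (elim z)
    then have "\<bar>w (fst z) (fst (snd z))\<bar> \<le> W"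
      using sets_eq_imp_space_eq[OF sets_Q] by (intro W sp) simp
    then show ?case
      unfolding h_def abs_mult using elim by (intro mult_mono) auto
  qed
  have spD: "space D = space (obs_space P0)"
    by (rule sets_eq_imp_space_eq) (rule sets_Q)
  interpret Q: prob_space D by (rule prob_space_Q)
  interpret Q: bounded_regression D g h L "W * Rmax"
  proof
    show "AE z in D. norm (g z) \<le> L"
      using g_bdd by (auto simp: spD)
  qed (use h_bdd in measurable)

  have \<beta>: "\<beta> = (\<integral>z. h z \<partial>D)"
    by (simp add: \<beta>_def D_def h_def w_def case_prod_beta')
  have gram: "gram D pie pib t = Q.gram_matrix"
    by (simp add: gram_def Q.gram_matrix_def g_def case_prod_beta')
  have g_mean: "(\<integral>z. g z $ i \<partial>D) = 0" for i
    using bandit.integral_context_mult_Fop[of "\<lambda>_. 1" "m i" G] Fm_bdd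
    by (simp add: g_def gF D_def F_def)
  have inner_mean: "(\<integral>z. g z \<bullet> u \<partial>D) = 0" for u
    unfolding inner_vec_def using Q.integrable_nth g_mean by (simp add: Bochner_Integration.integral_sum)
  have g_coef: "g z \<bullet> coef \<zeta> \<tau> = F (lin_model t \<zeta> \<tau>) (fst z) (fst (snd z))" for z \<zeta> \<tau>
    unfolding g_def F_def by (rule gvec_inner_coef)
  have ex_coef: "\<exists>\<zeta> \<tau>. u = coef \<zeta> \<tau>" for u :: "real^('d option)"
    by (metis coef_surj)

  obtain \<theta>s where orth: "\<And>j. (\<integral>z. (h z - g z \<bullet> \<theta>s) * g z $ j \<partial>D) = 0"
    using Q.ex_projection gram_nonsing by (auto simp: gram)
  define \<sigma>2 where "\<sigma>2 = (\<integral>z. (h z - g z \<bullet> \<theta>s)\<^sup>2 \<partial>D) - \<beta>\<^sup>2"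
  have min: "\<sigma>2 \<le> (\<integral>z. (h z - g z \<bullet> u)\<^sup>2 \<partial>D) - \<beta>\<^sup>2" for u
    using Q.projection_minimal[OF orth] by (simp add: \<sigma>2_def)
  \<comment> \<open>As g has mean zero, the mean is \<open>\<beta> + k\<close> for every u, and the
    shift k drops out of the variance. All variances in the claim thus become values of the
    minimized risk.\<close>
  have var: "var_D D (\<lambda>z. h z - g z \<bullet> u + k) = (\<integral>z. (h z - g z \<bullet> u)\<^sup>2 \<partial>D) - \<beta>\<^sup>2" for u k
  proof -
    have mean: "(\<integral>z. h z - g z \<bullet> u \<partial>D) = \<beta>"
      using Q.integrable_h Q.integrable_inner inner_mean by (simp add: \<beta>)
    then have "(\<integral>z. h z - g z \<bullet> u + k \<partial>D) = \<beta> + k"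
      using Q.integrable_residual by (simp add: Q.prob_space)
    then show ?thesis
      using Q.variance_eq[OF Q.integrable_residual Q.integrable_residual_sq, of u] mean
      by (simp add: var_D_def)
  qed

  \<comment> \<open>Limit law of the estimator\<close>
  have asymp: "asymp_normal M (\<lambda>n \<omega>. beta_emp pie pib t n Z \<omega> (xih n \<omega>) (tauh n \<omega>)) \<beta> \<sigma>2"
  proof -
    define \<theta> where "\<theta> n \<omega> = coef (xih n \<omega>) (tauh n \<omega>)" for n \<omega>
    have feasible_iff: "feasible pie pib t n Z \<omega> \<zeta> \<tau> \<longleftrightarrow> (\<forall>i<n. 0 < 1 + g (Z i \<omega>) \<bullet> coef \<zeta> \<tau>)" for n \<omega> \<zeta> \<tau>
      unfolding feasible_def g_coef by (simp add: F_def case_prod_beta')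
    have loglik: "emp_loglik pie pib t n Z \<omega> \<zeta> \<tau> = (\<Sum>i<n. ln (1 + g (Z i \<omega>) \<bullet> coef \<zeta> \<tau>)) / n" for n \<omega> \<zeta> \<tau>
      unfolding emp_loglik_def emp_mean_def g_coef by (simp add: F_def case_prod_beta')
    have beta_emp: "beta_emp pie pib t n Z \<omega> (xih n \<omega>) (tauh n \<omega>) = emp_mean n Z \<omega> (\<lambda>z. h z /
        (emp_mean n Z \<omega> (\<lambda>z. 1 / (1 + g z \<bullet> \<theta> n \<omega>)) * (1 + g z \<bullet> \<theta> n \<omega>)))" for n \<omega>
      unfolding beta_emp_def c_hat_def \<theta>_def g_coef by (simp add: F_def h_def w_def case_prod_beta')
    have "weak_conv_m (\<lambda>n. distr M borel (\<lambda>\<omega>. sqrt n * (emp_mean n Z \<omega> (\<lambda>z. h z /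
        (emp_mean n Z \<omega> (\<lambda>z. 1 / (1 + g z \<bullet> \<theta> n \<omega>)) * (1 + g z \<bullet> \<theta> n \<omega>))) - (\<integral>z. h z \<partial>D))))
      (normal_law ((\<integral>z. (h z - g z \<bullet> \<theta>s)\<^sup>2 \<partial>D) - (\<integral>z. h z \<partial>D)\<^sup>2))"
    proof (rule empirical_likelihood_weak_conv)
      show "invertible (\<chi> j k. \<integral>z. g z $ j * g z $ k \<partial>D)"
        using gram_nonsing by (simp add: gram Q.gram_matrix_def)
      show "\<theta> n \<in> borel_measurable M" for n
      proof (subst borel_measurable_euclidean_space, rule ballI)
        fix u :: "real^('d option)" assume "u \<in> Basis"
        then obtain i where u: "u = axis i 1"
          by (auto simp: Basis_vec_def)
        show "(\<lambda>\<omega>. \<theta> n \<omega> \<bullet> u) \<in> borel_measurable M"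
        proof (cases i)
          case None
          then show ?thesis
            using xih_meas by (simp add: u \<theta>_def coef_def inner_axis)
        next
          case (Some j)
          have "(\<lambda>\<omega>. tauh n \<omega> \<bullet> axis j 1) \<in> borel_measurable M"
            using tauh_meas by measurable
          then show ?thesis
            using Some by (simp add: u \<theta>_def coef_def inner_axis)
        qed
      qed
      fix n \<omega> assume \<omega>: "\<omega> \<in> Ev n"
      show "0 < 1 + g (Z i \<omega>) \<bullet> \<theta> n \<omega>" if "i < n" for i
        using Ev_max[OF \<omega>] that by (auto simp: is_emp_max_def feasible_iff \<theta>_def)
      show "(\<Sum>i<n. ln (1 + g (Z i \<omega>) \<bullet> \<theta>')) \<le> (\<Sum>i<n. ln (1 + g (Z i \<omega>) \<bullet> \<theta> n \<omega>))"
        if "\<And>i. i < n \<Longrightarrow> 0 < 1 + g (Z i \<omega>) \<bullet> \<theta>'" for \<theta>'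
      proof -
        obtain \<zeta> \<tau> where "\<theta>' = coef \<zeta> \<tau>"
          using ex_coef by blast
        \<comment> \<open>For n = 0 both sums are empty; otherwise the common divisor n cancels from
          the two log-likelihoods.\<close>
        then show ?thesis
          using Ev_max[OF \<omega>] that
          by (cases "n = 0") (auto simp: is_emp_max_def feasible_iff loglik \<theta>_def divide_le_cancel)
      qed
    qed (use g_bdd h_bdd g_mean orth Ev_sets Ev_prob in auto)
    then show ?thesis
      unfolding asymp_normal_def beta_emp \<beta> \<sigma>2_def .
  qed
  have risk: "(\<integral>(x,a,r). (w x a * r - F (lin_model t \<zeta> \<tau>) x a)\<^sup>2 \<partial>D) = (\<integral>z. (h z - g z \<bullet> coef \<zeta> \<tau>)\<^sup>2 \<partial>D)" for \<zeta> \<tau>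
    unfolding g_coef by (simp add: h_def case_prod_beta')
  \<comment> \<open>The minimum is attained: \<open>\<theta>s\<close> is itself the coefficient
    vector of some pair of parameters.\<close>
  have arg_min: "is_arg_min id (\<lambda>v. \<exists>\<zeta> \<tau>. v = (\<integral>(x,a,r). (w x a * r - F (lin_model t \<zeta> \<tau>) x a)\<^sup>2 \<partial>D) - \<beta>\<^sup>2) \<sigma>2"
    unfolding risk is_arg_min_def using min ex_coef[of \<theta>s] by (auto simp: not_less \<sigma>2_def)

  \<comment> \<open>Intrinsic efficiency\<close>
  have IS: "\<sigma>2 \<le> var_D D (\<lambda>(x,a,r). w x a * r)"
  proof -
    have "(\<lambda>(x,a,r). w x a * r) = (\<lambda>z. h z - g z \<bullet> 0 + 0)"
      by (auto simp: h_def)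
    then show ?thesis
      using min[of 0] unfolding var by (simp only: var)
  qed
  have SNIS: "\<sigma>2 \<le> var_D D (\<lambda>(x,a,r). w x a * (r - \<beta>))"
  proof -
    \<comment> \<open>The self-normalized estimator corresponds to the constant model \<beta>:
      \<open>w * r - F \<beta>\<close> equals \<open>w * (r - \<beta>)\<close> up to the additive
      constant \<beta>, which the variance ignores.\<close>
    have "F (lin_model t \<beta> 0) x a = \<beta> * w x a - \<beta>" for x a
      using sum_pmf_eq_1[of UNIV "pie x"]
      by (simp add: F_def Fop_def lin_model_def w_def mult.commute flip: sum_distrib_left)
    then have "(\<lambda>(x,a,r). w x a * (r - \<beta>)) = (\<lambda>z. h z - g z \<bullet> coef \<beta> 0 + (- \<beta>))"
      unfolding g_coef by (auto simp: h_def algebra_simps)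
    then show ?thesis
      using min[of "coef \<beta> 0"] by (simp only: var)
  qed
  have DR: "\<sigma>2 \<le> var_D D (\<lambda>(x,a,r). w x a * r - F (lin_model t 0 \<tau>d) x a)" for \<tau>d
  proof -
    have "(\<lambda>(x,a,r). w x a * r - F (lin_model t 0 \<tau>d) x a) = (\<lambda>z. h z - g z \<bullet> coef 0 \<tau>d + 0)"
      unfolding g_coef by (auto simp: h_def)
    then show ?thesis
      using min[of "coef 0 \<tau>d"] by (simp only: var)
  qed

  \<comment> \<open>Local efficiency under a correct model\<close>
  have local_eff: "\<sigma>2 = var_D D (\<lambda>(x,a,r). w x a * (r - t x a \<bullet> \<tau>0) + (\<Sum>a'\<in>UNIV. (t x a' \<bullet> \<tau>0) * pmf (pie x) a'))"
    if model: "\<forall>x\<in>space P0. \<forall>a. (\<integral>r. r \<partial>Pr x a) = t x a \<bullet> \<tau>0" for \<tau>0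
  proof -
    define V where "V x = (\<Sum>a'\<in>UNIV. (t x a' \<bullet> \<tau>0) * pmf (pie x) a')" for x
    have decomp: "h z - g z \<bullet> coef 0 \<tau>0 = w (fst z) (fst (snd z)) * (snd (snd z) - t (fst z) (fst (snd z)) \<bullet> \<tau>0) + V (fst z)" for z
      unfolding g_coef by (simp add: h_def F_def Fop_def w_def lin_model_def V_def right_diff_distrib)
    have t_inner [measurable]: "(\<lambda>x. t x a \<bullet> \<tau>0) \<in> borel_measurable P0" for a
      unfolding inner_vec_def using t_meas by simp
    have V_meas [measurable]: "V \<in> borel_measurable P0"
      unfolding V_def using pie_meas by measurable
    have q_bdd: "\<bar>t x a \<bullet> \<tau>0\<bar> \<le> B * norm \<tau>0" if "x \<in> space P0" for x a
      using Cauchy_Schwarz_ineq2[of "t x a" \<tau>0] mult_right_mono[OF B[OF that, of a], of "norm \<tau>0"] by simp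
    \<comment> \<open>The residual is weighted reward noise plus the context function V. Times
      \<open>F (m i)\<close>, the first part vanishes by conditioning on context and action, the
      second by conditioning on the context alone.\<close>
    have "(\<integral>z. (h z - g z \<bullet> coef 0 \<tau>0) * g z $ i \<partial>D) = 0" for i
    proof -
      let ?A = "\<lambda>z. (w (fst z) (fst (snd z)) * F (m i) (fst z) (fst (snd z))) * (snd (snd z) - t (fst z) (fst (snd z)) \<bullet> \<tau>0)"
      let ?B = "\<lambda>z. V (fst z) * F (m i) (fst z) (fst (snd z))"
      have V_bdd: "\<bar>V x\<bar> \<le> B * norm \<tau>0" if "x \<in> space P0" for x
      proof -
        have "\<bar>V x\<bar> \<le> (\<Sum>a'\<in>UNIV. \<bar>(t x a' \<bullet> \<tau>0) * pmf (pie x) a'\<bar>)"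
          unfolding V_def by (rule sum_abs)
        also have "\<dots> \<le> (\<Sum>a'\<in>UNIV. (B * norm \<tau>0) * pmf (pie x) a')"
          using q_bdd[OF that] by (intro sum_mono) (simp add: abs_mult mult_right_mono)
        also have "\<dots> = B * norm \<tau>0"
          unfolding sum_distrib_left[symmetric] by (simp add: sum_pmf_eq_1)
        finally show ?thesis .
      qed
      have VF: "\<bar>V x * F (m i) x a\<bar> \<le> (B * norm \<tau>0) * G" if "x \<in> space P0" for x a
        unfolding abs_mult using V_bdd[OF that] Fm_bdd[OF that] order_trans[OF abs_ge_zero V_bdd[OF that]]
        by (intro mult_mono) auto
      have wF: "\<bar>w x a * F (m i) x a\<bar> \<le> W * G" if "x \<in> space P0" for x a
        unfolding abs_mult using W[OF that] Fm_bdd[OF that] order_trans[OF abs_ge_zero W[OF that]]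
        by (intro mult_mono) auto
      have [measurable]: "?B \<in> borel_measurable (obs_space P0)"
        by (intro bandit.measurable_obs_action[where f = "\<lambda>a x. V x * F (m i) x a"]) measurable
      have intB: "integrable D ?B"
        using VF[OF sp] by (intro Q.integrable_bounded[where c = "(B * norm \<tau>0) * G"]) (auto simp: spD)
      have eq: "(h z - g z \<bullet> coef 0 \<tau>0) * g z $ i = ?A z + ?B z" for z
        unfolding decomp by (simp add: g_def gF algebra_simps)
      \<comment> \<open>The noise part inherits integrability as the difference of the whole product
        and the bounded context part.\<close>
      have "integrable D (\<lambda>z. (h z - g z \<bullet> coef 0 \<tau>0) * g z $ i)"
        using Q.integrable_residual_mult[of "coef 0 \<tau>0" "axis i 1"] by (simp add: inner_axis)
      from Bochner_Integration.integrable_diff[OF this intB] have intA: "integrable D ?A"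
        unfolding eq by simp
      have "(\<integral>z. ?A z \<partial>D) = 0"
        unfolding D_def
      proof (rule bandit.integral_mult_reward_residual[where \<psi> = "\<lambda>x a. w x a * F (m i) x a"])
        show "(\<lambda>x. w x a * F (m i) x a) \<in> borel_measurable P0" for a
          unfolding w_def by measurable
      qed (use wF q_bdd model t_inner in auto)
      moreover have "(\<integral>z. ?B z \<partial>D) = 0"
        unfolding D_def F_def
        by (rule bandit.integral_context_mult_Fop[OF V_meas m_meas VF[unfolded F_def]])
      ultimately show ?thesis
        unfolding eq using intA intB by simp
    qed
    \<comment> \<open>Orthogonality makes \<open>coef 0 \<tau>0\<close> a minimizer too, so its risk
      agrees with that of \<open>\<theta>s\<close> by comparison in both directions.\<close>
    then have "(\<integral>z. (h z - g z \<bullet> coef 0 \<tau>0)\<^sup>2 \<partial>D) - \<beta>\<^sup>2 \<le> \<sigma>2"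
      using Q.projection_minimal by (simp add: \<sigma>2_def)
    with min[of "coef 0 \<tau>0"] have "\<sigma>2 = var_D D (\<lambda>z. h z - g z \<bullet> coef 0 \<tau>0 + 0)"
      by (simp only: var)
    also have "(\<lambda>z. h z - g z \<bullet> coef 0 \<tau>0 + 0) = (\<lambda>(x,a,r). w x a * (r - t x a \<bullet> \<tau>0) + (\<Sum>a'\<in>UNIV. (t x a' \<bullet> \<tau>0) * pmf (pie x) a'))"
      unfolding decomp by (auto simp: V_def)
    finally show ?thesis .
  qed
  show ?thesis
    using asymp arg_min IS SNIS DR local_eff by blast
qed

end
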